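(* Let $C\ge 2$ be a positive integer. Let $(i_1,j_1),\ldots,(i_L,j_L)$ be a fixed sequence of indices and let $\alpha_1,\ldots,\alpha_L$ be $L$ fixed positive integers. Let $X=(X_{ij})_{1\le i,j\le n}$ be uniformly distributed on $\mathscr M(Cn,n)$. Then, as $n\to\infty$, $$\mathbb E\left[\prod_{k=1}^L X_{i_k,j_k}^{\alpha_k}\right]\to \mathbb E\left[\prod_{k=1}^L Y_k^{\alpha_k}\right],$$ where $Y_1,\ldots,Y_L$ are i.i.d. geometric random variables with mean $C$.
   Context: $\mathscr M(Cn,n)$ denotes the set of $n\times n$ matrices with non-negative integer entries all of whose row sums and column sums are equal to $Cn$. The geometric distribution with mean $C$ is the law of a random variable $Y$ with $\mathbb P(Y=x)=\frac{1}{1+C}\left(\frac{C}{1+C}\right)^x$ for integers $x\ge 0$.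
   Formalization: The indices (i_1,j_1),…,(i_L,j_L) are assumed pairwise distinct; with a repeated index the claim fails (e.g. L=2, equal positions, exponents 1: the left side tends to E[Y²]=C+2C², the right side is C²). *)

theory Defs
  imports "HOL-Probability.Probability" "Jordan_Normal_Form.Matrix"
begin

definition margin_mats :: "nat \<Rightarrow> nat \<Rightarrow> nat mat set" where
  "margin_mats N n = {A \<in> carrier_mat n n.
     (\<forall>i<n. (\<Sum>j<n. A $$ (i, j)) = N) \<and> (\<forall>j<n. (\<Sum>i<n. A $$ (i, j)) = N)}"

text \<open>Finiteness and nonemptiness of the set are what makes \<^term>\<open>pmf_of_set\<close> on it the
  uniform distribution (otherwise that term is unspecified).\<close>

lemma finite_margin_mats: "finite (margin_mats N n)"
proof (rule finite_subset)
  let ?F = "PiE ({..<n} \<times> {..<n}) (\<lambda>_. {..N})"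
  show "margin_mats N n \<subseteq> (\<lambda>f. mat n n f) ` ?F"
  proof
    fix A assume A: "A \<in> margin_mats N n"
    let ?f = "restrict (\<lambda>p. A $$ p) ({..<n} \<times> {..<n})"
    have "A $$ (i, j) \<le> N" if "i < n" "j < n" for i j
    proof -
      have "A $$ (i, j) \<le> (\<Sum>j<n. A $$ (i, j))"
        using that by (intro member_le_sum) auto
      then show ?thesis using A that by (simp add: margin_mats_def)
    qed
    then have "?f \<in> ?F" by auto
    moreover have "A = mat n n ?f"
      using A by (intro eq_matI) (auto simp: margin_mats_def)
    ultimately show "A \<in> (\<lambda>f. mat n n f) ` ?F" by blast
  qed
  show "finite ((\<lambda>f. mat n n f) ` ?F)"
    by (intro finite_imageI finite_PiE) auto
qed

lemma margin_mats_nonempty: "margin_mats N n \<noteq> {}"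
proof -
  have "mat n n (\<lambda>(i, j). if i = j then N else 0) \<in> margin_mats N n"
    by (auto simp: margin_mats_def)
  then show ?thesis by blast
qed

end

theory Submission
  imports Defs "HOL-Real_Asymp.Real_Asymp"
begin

text \<open>Write \<open>x\<close> for a uniform table and \<open>\<nu> j\<close> for the number of nonzero entries of its column \<open>j\<close>.

  Given all other columns and the sums of the two entries in each row, a pair of columns amounts to
  a uniform point of a box on the central slice, so \<open>\<nu> j\<close> and \<open>\<nu> k\<close> differ by less than
  \<open>n powr (3/4)\<close> except on a set of superpolynomially small proportion; a counting argument shows
  that some column has at least \<open>n powr (7/8)\<close> nonzero entries. Hence all ratios \<open>\<nu> j / \<nu> k\<close> are
  close to 1.

  The switching that decreases the entries \<open>(a, b)\<close>, \<open>(i, j)\<close> and increases \<open>(a, j)\<close>, \<open>(i, b)\<close>, used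
  with weight \<open>(x a j + 1) / \<nu> j\<close>, then gives \<open>(1 + C) E[\<phi>] = C E[\<phi>\<^sup>+] + o(1)\<close> for every
  polynomial test function \<open>\<phi>\<close> vanishing when \<open>x a b = 0\<close>, where \<open>\<phi>\<^sup>+\<close> is \<open>\<phi>\<close> with \<open>x a b\<close> increased
  by 1: the two sides are governed by the row sums of \<open>x a j + 1\<close> and of \<open>x a j\<close>, which are about
  \<open>(1 + C) n\<close> and \<open>C n\<close>. For monomials this is the recursion that characterises the moments of the
  geometric distribution.\<close>

section \<open>Boxes and their central slices\<close>

definition nbox :: "nat \<Rightarrow> (nat \<Rightarrow> nat) \<Rightarrow> (nat \<Rightarrow> nat) set" where
  "nbox n s = (\<Pi>\<^sub>E i\<in>{..<n}. {..s i})"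

lemma finite_nbox [simp]: "finite (nbox n s)"
  unfolding nbox_def by (intro finite_PiE) auto

lemma card_nbox: "card (nbox n s) = (\<Prod>i<n. Suc (s i))"
  unfolding nbox_def by (simp add: card_PiE)

text \<open>The level \<open>k\<close> is an integer, so that the reflection \<open>S - k\<close>
  and the shifts \<open>k - int v\<close> need no truncated subtraction; negative levels simply
  count 0.\<close>

definition slice_count :: "nat \<Rightarrow> (nat \<Rightarrow> nat) \<Rightarrow> int \<Rightarrow> nat" where
  "slice_count n s k = card {g \<in> nbox n s. int (\<Sum>i<n. g i) = k}"

lemma slice_count_Suc:
  "slice_count (Suc n) s k = (\<Sum>v\<le>s n. slice_count n s (k - int v))"
proof -
  let ?A = "SIGMA v:{..s n}. {g \<in> nbox n s. int (\<Sum>i<n. g i) = k - int v}"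
  let ?F = "\<lambda>(v, g). g(n := v)"
  have inj: "inj_on ?F ({..s n} \<times> nbox n s)"
    unfolding nbox_def using inj_combinator[of n "{..<n}" "\<lambda>i. {..s i}"] by simp
  have box: "nbox (Suc n) s = ?F ` ({..s n} \<times> nbox n s)"
    unfolding nbox_def lessThan_Suc PiE_insert_eq ..
  have sum: "(\<Sum>i<Suc n. (g(n := v)) i) = (\<Sum>i<n. g i) + v" for g :: "nat \<Rightarrow> nat" and v
    by simp
  have eq: "{g \<in> nbox (Suc n) s. int (\<Sum>i<Suc n. g i) = k} = ?F ` ?A"
    unfolding box by (auto simp: image_iff algebra_simps) 
  have "slice_count (Suc n) s k = card ?A"
    unfolding slice_count_def eq
    by (intro card_image inj_on_subset[OF inj]) auto
  then show ?thesis
    by (simp add: slice_count_def card_SigmaI)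
qed

text \<open>A new coordinate convolves the slice counts with the indicator of
  \<open>{0..s n}\<close>. This keeps symmetry, and the increment from level \<open>k\<close> to
  \<open>k + 1\<close> becomes \<open>?f (k + 1) - ?f (k - int (s n))\<close>. Below the centre the
  first argument is at least as central as the second, so the increment is nonnegative.\<close>

lemma slice_count_symmetric_unimodal:
  "(\<forall>k. slice_count n s (int (\<Sum>i<n. s i) - k) = slice_count n s k) \<and>
   (\<forall>k. 2 * k + 1 \<le> int (\<Sum>i<n. s i) \<longrightarrow> slice_count n s k \<le> slice_count n s (k + 1))"
proof (induction n)
  case 0
  have "slice_count 0 s k = (if k = 0 then 1 else 0)" for k
    by (simp add: slice_count_def nbox_def)
  then show ?case by auto
next
  case (Suc n)
  let ?f = "slice_count n s" and ?S = "int (\<Sum>i<n. s i)"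
  have sym: "?f (?S - k) = ?f k" for k
    using Suc by blast
  have step: "2 * k + 1 \<le> ?S \<Longrightarrow> ?f k \<le> ?f (k + 1)" for k
    using Suc by blast
  have mono: "?f k \<le> ?f l" if "k \<le> l" "2 * l \<le> ?S + 1" for k l
    using that
  proof (induction l rule: int_ge_induct)
    case (step i)
    then show ?case using \<open>2 * (i + 1) \<le> ?S + 1\<close> Suc by (smt (verit) le_trans)
  qed simp
  have "slice_count (Suc n) s (int (\<Sum>i<Suc n. s i) - k) = slice_count (Suc n) s k" for k
  proof -
    have "slice_count (Suc n) s (int (\<Sum>i<Suc n. s i) - k)
        = (\<Sum>v\<le>s n. ?f (?S - (k - int (s n - v))))"
      unfolding slice_count_Suc by (intro sum.cong refl) (auto simp: of_nat_diff algebra_simps)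
    also have "\<dots> = (\<Sum>v\<le>s n. ?f (k - int (s n - v)))"
      by (simp only: sym)
    also have "\<dots> = (\<Sum>v\<le>s n. ?f (k - int v))"
      by (rule sum.reindex_bij_witness[of _ "\<lambda>v. s n - v" "\<lambda>v. s n - v"]) auto
    finally show ?thesis unfolding slice_count_Suc .
  qed
  moreover have "slice_count (Suc n) s k \<le> slice_count (Suc n) s (k + 1)"
    if k: "2 * k + 1 \<le> int (\<Sum>i<Suc n. s i)" for k
  proof -
    \<comment> \<open>The windows of summation for \<open>k\<close> and \<open>k + 1\<close> differ
      only in these two end terms.\<close>
    have "?f (k - int (s n)) \<le> ?f (k + 1)"
    proof (cases "2 * (k + 1) \<le> ?S + 1")
      case True
      then show ?thesis by (intro mono) auto
    next
      case False
      \<comment> \<open>Past the centre, \<open>k + 1\<close> is reflected to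
        \<open>?S - (k + 1)\<close>; the assumption on \<open>k\<close> says exactly that
        \<open>k - int (s n)\<close> lies at or below this point.\<close>
      then have "?f (k - int (s n)) \<le> ?f (?S - (k + 1))"
        using k by (intro mono) auto
      then show ?thesis by (simp only: sym)
    qed
    moreover have "(\<Sum>v\<le>s n. ?f (k - int v)) = (\<Sum>v<s n. ?f (k - int v)) + ?f (k - int (s n))"
      by (simp add: lessThan_Suc_atMost[symmetric])
    moreover have "(\<Sum>v\<le>s n. ?f (k + 1 - int v)) = ?f (k + 1) + (\<Sum>v<s n. ?f (k - int v))"
      by (simp only: lessThan_Suc_atMost[symmetric] sum.lessThan_Suc_shift) (simp add: algebra_simps)
    ultimately show ?thesis unfolding slice_count_Suc by simp
  qed
  ultimately show ?case by blast
qed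

text \<open>The coordinate sum takes at most \<open>2 * N + 1\<close> values on the box, and by
  symmetry and unimodality the level \<open>N\<close> is the most populated one.\<close>

lemma card_nbox_le_central_slice:
  assumes "(\<Sum>i<n. s i) = 2 * N"
  shows "card (nbox n s) \<le> (2 * N + 1) * card {g \<in> nbox n s. (\<Sum>i<n. g i) = N}"
proof -
  have sym: "slice_count n s (2 * int N - k) = slice_count n s k"
    and incr: "2 * k + 1 \<le> 2 * int N \<Longrightarrow> slice_count n s k \<le> slice_count n s (k + 1)" for k
    using slice_count_symmetric_unimodal[of n s] assms by auto
  have low: "slice_count n s k \<le> slice_count n s (int N)" if "k \<le> int N" for k
    using that
  proof (induction k rule: int_le_induct)
    case (step i)
    then show ?case using \<open>i \<le> int N\<close> incr[of "i - 1"] by simp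
  qed simp
  have max: "slice_count n s k \<le> slice_count n s (int N)" for k
    using low[of k] low[of "2 * int N - k"] sym[of k] by (cases "k \<le> int N") auto
  have le: "(\<Sum>i<n. g i) \<le> 2 * N" if "g \<in> nbox n s" for g
    unfolding assms[symmetric] using that by (intro sum_mono) (auto simp: nbox_def)
  have "nbox n s = (\<Union>k\<le>2 * N. {g \<in> nbox n s. int (\<Sum>i<n. g i) = int k})"
    using le by (auto simp flip: of_nat_sum)
  also have "card \<dots> \<le> (\<Sum>k\<le>2 * N. slice_count n s (int k))"
    unfolding slice_count_def by (intro card_UN_le) auto
  also have "\<dots> \<le> (\<Sum>k\<le>2 * N. slice_count n s (int N))"
    by (intro sum_mono max)
  finally show ?thesis unfolding slice_count_def of_nat_eq_iff by simp
qed

text \<open>If \<open>v\<close> is one of two entries with sum \<open>s\<close>, this is the indicator that \<open>v\<close> is nonzero minus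
  the indicator that the other entry \<open>s - v\<close> is nonzero; it is symmetric for uniform \<open>v \<le> s\<close>.\<close>

definition end_diff :: "nat \<Rightarrow> nat \<Rightarrow> real" where
  "end_diff s v = of_bool (v = s) - of_bool (v = 0)"

section \<open>Exponential moments and tail bounds on a box\<close>

lemma exp_add_exp_minus_le:
  fixes \<theta> :: real
  assumes "\<bar>\<theta>\<bar> \<le> 1"
  shows "exp \<theta> + exp (- \<theta>) \<le> 2 + 2 * \<theta>\<^sup>2"
proof -
  have *: "exp t + exp (- t) \<le> 2 + 2 * t\<^sup>2" if "0 \<le> t" "t \<le> 1" for t :: real
  proof -
    have "exp t \<le> 1 + t + t\<^sup>2" using that by (rule exp_bound)
    moreover have "exp (- t) \<le> 1 - t + t\<^sup>2"
    proof -
      \<comment> \<open>The product equals 1 + t^3.\<close>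
      have "1 \<le> (1 + t) * (1 - t + t\<^sup>2)"
        using that by (simp add: algebra_simps power2_eq_square)
      also have "\<dots> \<le> exp t * (1 - t + t\<^sup>2)"
        using that by (intro mult_right_mono exp_ge_add_one_self) (auto)
      finally show ?thesis by (simp add: exp_minus field_simps)
    qed
    ultimately show ?thesis by simp
  qed
  show ?thesis
    using *[of \<theta>] *[of "- \<theta>"] assms by (cases "\<theta> \<ge> 0") (auto simp: add.commute)
qed

text \<open>Only the end values 0 and \<open>s\<close> deviate from the summand 1, and in opposite
  directions. The first-order terms cancel and a factor 1 + \<theta>^2 per value suffices.\<close>

lemma sum_exp_end_diff_le:
  fixes \<theta> :: real
  assumes "\<bar>\<theta>\<bar> \<le> 1"
  shows "(\<Sum>v\<le>s. exp (\<theta> * end_diff s v)) \<le> real (Suc s) * exp (\<theta>\<^sup>2)"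
proof (cases "s = 0")
  case True
  then show ?thesis by (simp add: end_diff_def)
next
  case False
  have set: "{..s} = insert 0 (insert s {1..<s})" using False by auto
  have "(\<Sum>v\<in>{1..<s}. exp (\<theta> * end_diff s v)) = (\<Sum>v\<in>{1..<s}. 1)"
    by (intro sum.cong) (auto simp: end_diff_def)
  then have "(\<Sum>v\<le>s. exp (\<theta> * end_diff s v)) = exp (- \<theta>) + exp \<theta> + real (s - 1)"
    using False unfolding set by (simp add: end_diff_def)
  also have "\<dots> \<le> 2 + 2 * \<theta>\<^sup>2 + real (s - 1) * (1 + \<theta>\<^sup>2)"
  proof -
    have "0 \<le> real (s - 1) * \<theta>\<^sup>2" by simp
    then show ?thesis
      using exp_add_exp_minus_le[OF assms] unfolding distrib_left mult_1_right by linarith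
  qed
  also have "\<dots> = real (Suc s) * (1 + \<theta>\<^sup>2)"
    using False by (simp add: of_nat_diff algebra_simps)
  also have "\<dots> \<le> real (Suc s) * exp (\<theta>\<^sup>2)"
    by (intro mult_left_mono exp_ge_add_one_self) auto
  finally show ?thesis .
qed

text \<open>The coordinates of a box are independent, so the exponential moment is a product over
  \<open>i\<close>. Coordinates outside \<open>I\<close> contribute their full range
  \<open>Suc (s i)\<close>, which obeys the same bound; hence the exponent \<open>n\<close> for
  every \<open>I\<close>.\<close>

lemma sum_nbox_exp_end_diff_le:
  fixes \<theta> :: real
  assumes "\<bar>\<theta>\<bar> \<le> 1" "I \<subseteq> {..<n}"
  shows "(\<Sum>g\<in>nbox n s. exp (\<theta> * (\<Sum>i\<in>I. end_diff (s i) (g i))))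
           \<le> real (card (nbox n s)) * exp (real n * \<theta>\<^sup>2)"
proof -
  let ?e = "\<lambda>i v. if i \<in> I then exp (\<theta> * end_diff (s i) v) else 1"
  have "(\<Sum>g\<in>nbox n s. exp (\<theta> * (\<Sum>i\<in>I. end_diff (s i) (g i)))) = (\<Sum>g\<in>nbox n s. \<Prod>i<n. ?e i (g i))"
  proof (intro sum.cong refl)
    fix g
    have "(\<Prod>i<n. ?e i (g i)) = (\<Prod>i\<in>I. exp (\<theta> * end_diff (s i) (g i)))"
      using assms(2) by (subst prod.If_cases) (auto simp: Int_absorb1)
    then show "exp (\<theta> * (\<Sum>i\<in>I. end_diff (s i) (g i))) = (\<Prod>i<n. ?e i (g i))"
      using finite_subset[OF assms(2)] by (simp add: exp_sum sum_distrib_left)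
  qed
  also have "\<dots> = (\<Prod>i<n. \<Sum>v\<le>s i. ?e i v)"
    unfolding nbox_def by (subst prod_sum_PiE) auto
  also have "\<dots> \<le> (\<Prod>i<n. real (Suc (s i)) * exp (\<theta>\<^sup>2))"
  proof (intro prod_mono conjI)
    fix i
    show "(\<Sum>v\<le>s i. ?e i v) \<le> real (Suc (s i)) * exp (\<theta>\<^sup>2)"
      using sum_exp_end_diff_le[OF assms(1), of "s i"] by (cases "i \<in> I") auto
  qed (auto intro!: sum_nonneg)
  also have "\<dots> = real (card (nbox n s)) * exp (real n * \<theta>\<^sup>2)"
    by (simp add: prod.distrib card_nbox exp_of_nat_mult)
  finally show ?thesis .
qed

text \<open>This is a Chernoff bound; the factor 2 pays for the two signs of the deviation.\<close>

lemma card_nbox_end_diff_tail: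
  fixes r :: real
  assumes "0 \<le> r" "r \<le> real n" "I \<subseteq> {..<n}" "n > 0"
  shows "real (card {g \<in> nbox n s. \<bar>\<Sum>i\<in>I. end_diff (s i) (g i)\<bar> \<ge> r})
           \<le> 2 * real (card (nbox n s)) * exp (- (r\<^sup>2 / (4 * real n)))"
proof -
  \<comment> \<open>This choice minimises n \<theta>^2 - \<theta> r, with minimum - r^2 / (4 n);
    since \<open>r \<le> n\<close>, it stays in the range where the exponential moment bound is
    available.\<close>
  define \<theta> where "\<theta> = r / (2 * real n)"
  have \<theta>: "0 \<le> \<theta>" "\<bar>\<theta>\<bar> \<le> 1" "\<bar>- \<theta>\<bar> \<le> 1" using assms by (auto simp: \<theta>_def)
  let ?S = "\<lambda>g. \<Sum>i\<in>I. end_diff (s i) (g i)"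
  let ?B = "{g \<in> nbox n s. \<bar>?S g\<bar> \<ge> r}"
  have "real (card ?B) * exp (\<theta> * r) = (\<Sum>g\<in>?B. exp (\<theta> * r))" by simp
  also have "\<dots> \<le> (\<Sum>g\<in>?B. exp (\<theta> * ?S g) + exp (- \<theta> * ?S g))"
  proof (intro sum_mono)
    fix g assume "g \<in> ?B"
    then have "r \<le> ?S g \<or> r \<le> - ?S g" by auto
    then have "\<theta> * r \<le> \<theta> * ?S g \<or> \<theta> * r \<le> \<theta> * (- ?S g)"
      using \<theta>(1) by (blast intro: mult_left_mono)
    then have "exp (\<theta> * r) \<le> exp (\<theta> * ?S g) \<or> exp (\<theta> * r) \<le> exp (- \<theta> * ?S g)" by auto
    then show "exp (\<theta> * r) \<le> exp (\<theta> * ?S g) + exp (- \<theta> * ?S g)"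
      using exp_ge_zero[of "\<theta> * ?S g"] exp_ge_zero[of "- \<theta> * ?S g"] by linarith
  qed
  also have "\<dots> \<le> (\<Sum>g\<in>nbox n s. exp (\<theta> * ?S g) + exp (- \<theta> * ?S g))"
    by (intro sum_mono2) (auto intro: add_nonneg_nonneg)
  also have "\<dots> \<le> 2 * (real (card (nbox n s)) * exp (real n * \<theta>\<^sup>2))"
    unfolding sum.distrib
    using sum_nbox_exp_end_diff_le[OF \<theta>(2) assms(3), of s] sum_nbox_exp_end_diff_le[OF \<theta>(3) assms(3), of s]
    by simp
  finally have "real (card ?B) \<le> 2 * real (card (nbox n s)) * (exp (real n * \<theta>\<^sup>2) / exp (\<theta> * r))"
    by (simp add: field_simps)
  also have "exp (real n * \<theta>\<^sup>2) / exp (\<theta> * r) = exp (- (r\<^sup>2 / (4 * real n)))"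
    unfolding exp_diff[symmetric] using assms(4)
    by (simp add: \<theta>_def power2_eq_square field_simps)
  finally show ?thesis .
qed

section \<open>Tables with constant margins\<close>

text \<open>Tables of all sizes share one type and are 0 outside the square. One test function can
  thus serve for every \<open>n\<close>, and no index conditions are needed to read an
  entry.\<close>

definition tables :: "nat \<Rightarrow> nat \<Rightarrow> (nat \<Rightarrow> nat \<Rightarrow> nat) set" where
  "tables N n = {x. (\<forall>i j. i \<ge> n \<or> j \<ge> n \<longrightarrow> x i j = 0) \<and>
     (\<forall>i<n. (\<Sum>j<n. x i j) = N) \<and> (\<forall>j<n. (\<Sum>i<n. x i j) = N)}"

lemma tables_outside: "x \<in> tables N n \<Longrightarrow> i \<ge> n \<or> j \<ge> n \<Longrightarrow> x i j = 0"
  and tables_row_sum: "x \<in> tables N n \<Longrightarrow> i < n \<Longrightarrow> (\<Sum>j<n. x i j) = N"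
  and tables_col_sum: "x \<in> tables N n \<Longrightarrow> j < n \<Longrightarrow> (\<Sum>i<n. x i j) = N"
  by (auto simp: tables_def)

lemma tables_le:
  assumes "x \<in> tables N n"
  shows "x i j \<le> N"
proof (cases "i < n \<and> j < n")
  case True
  then have "x i j \<le> (\<Sum>j<n. x i j)" by (intro member_le_sum) auto
  then show ?thesis using True assms by (simp add: tables_row_sum)
next
  case False
  then show ?thesis using assms by (auto simp: tables_outside)
qed

lemma bij_betw_margin_mats_tables:
  "bij_betw (\<lambda>X i j. if i < n \<and> j < n then X $$ (i, j) else 0) (margin_mats N n) (tables N n)"
  by (rule bij_betw_byWitness[where f' = "\<lambda>x. mat n n (\<lambda>(i, j). x i j)"])
     (auto simp: margin_mats_def tables_def fun_eq_iff intro!: eq_matI)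

lemma finite_tables [simp]: "finite (tables N n)"
  using bij_betw_finite[OF bij_betw_margin_mats_tables] finite_margin_mats by blast

lemma tables_nonempty: "tables N n \<noteq> {}"
  using bij_betw_margin_mats_tables[of n N] margin_mats_nonempty[of N n]
  by (auto simp: bij_betw_def)

section \<open>Column supports and redistribution between two columns\<close>

definition nonzeros :: "nat set \<Rightarrow> (nat \<Rightarrow> nat \<Rightarrow> nat) \<Rightarrow> nat \<Rightarrow> nat" where
  "nonzeros I x j = card {i \<in> I. x i j \<noteq> 0}"

text \<open>This map forgets only how each row splits its mass between the columns \<open>j\<close>
  and \<open>k\<close>. Its fibres are the conditional spaces on which a pair of columns is
  uniform.\<close>

definition merge_cols :: "nat \<Rightarrow> nat \<Rightarrow> (nat \<Rightarrow> nat \<Rightarrow> nat) \<Rightarrow> nat \<Rightarrow> nat \<Rightarrow> nat" where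
  "merge_cols j k x = (\<lambda>i l. if l = j then x i j + x i k else if l = k then 0 else x i l)"

lemma sum_two_cols:
  fixes f :: "nat \<Rightarrow> nat"
  assumes "j < n" "k < n" "j \<noteq> k"
  shows "(\<Sum>l<n. f l) = f j + f k + (\<Sum>l\<in>{..<n} - {j, k}. f l)"
proof -
  have "{..<n} = insert j (insert k ({..<n} - {j, k}))" using assms by auto
  then have "(\<Sum>l<n. f l) = (\<Sum>l\<in>insert j (insert k ({..<n} - {j, k})). f l)" by simp
  also have "\<dots> = f j + f k + (\<Sum>l\<in>{..<n} - {j, k}. f l)" using assms by simp
  finally show ?thesis .
qed

text \<open>Column \<open>j\<close> determines the table: column \<open>k\<close> is the remainder
  \<open>s - g\<close> and all other columns are those of \<open>y\<close>. Row sums are automatic,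
  and since \<open>s\<close> has total \<open>2 * N\<close>, both column conditions reduce to
  \<open>g\<close> having sum \<open>N\<close>.\<close>

lemma bij_betw_merge_cols_fibre:
  assumes y: "y \<in> tables N n" and jk: "j < n" "k < n" "j \<noteq> k"
  defines "s \<equiv> \<lambda>i. y i j + y i k"
  shows "bij_betw (\<lambda>x. \<lambda>i\<in>{..<n}. x i j) {x \<in> tables N n. merge_cols j k x = merge_cols j k y}
           {g \<in> nbox n s. (\<Sum>i<n. g i) = N}"
proof -
  have fib: "x i j + x i k = s i" "l \<noteq> j \<Longrightarrow> l \<noteq> k \<Longrightarrow> x i l = y i l"
    if "merge_cols j k x = merge_cols j k y" for x i l
    using fun_cong[OF fun_cong[OF that, of i], of j] fun_cong[OF fun_cong[OF that, of i], of l] jk(3)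
    by (auto simp: merge_cols_def s_def)
  define G where "G = (\<lambda>g i l. if i < n then (if l = j then g i else if l = k then s i - g i else y i l) else 0 :: nat)"
  have s_out: "s i = 0" if "i \<ge> n" for i using y that by (simp add: s_def tables_outside)
  have sum_s: "(\<Sum>i<n. s i) = 2 * N"
    using y jk by (simp add: s_def sum.distrib tables_col_sum)
  show ?thesis
  proof (rule bij_betw_byWitness[where f' = G])
    show "\<forall>x\<in>{x \<in> tables N n. merge_cols j k x = merge_cols j k y}. G (\<lambda>i\<in>{..<n}. x i j) = x"
    proof (clarify, intro ext)
      fix x i l
      assume x: "x \<in> tables N n" and m: "merge_cols j k x = merge_cols j k y"
      show "G (\<lambda>i\<in>{..<n}. x i j) i l = x i l"
        using x fib(1)[OF m, of i] fib(2)[OF m, of l i] by (auto simp: G_def tables_outside)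
    qed
    show "\<forall>g\<in>{g \<in> nbox n s. (\<Sum>i<n. g i) = N}. (\<lambda>i\<in>{..<n}. G g i j) = g"
      by (auto simp: G_def nbox_def fun_eq_iff PiE_def extensional_def)
    show "(\<lambda>x. \<lambda>i\<in>{..<n}. x i j) ` {x \<in> tables N n. merge_cols j k x = merge_cols j k y}
            \<subseteq> {g \<in> nbox n s. (\<Sum>i<n. g i) = N}"
    proof clarify
      fix x
      assume x: "x \<in> tables N n" and m: "merge_cols j k x = merge_cols j k y"
      have "x i j \<le> s i" for i using fib(1)[OF m, of i] by simp
      then show "(\<lambda>i\<in>{..<n}. x i j) \<in> nbox n s \<and> (\<Sum>i<n. (\<lambda>i\<in>{..<n}. x i j) i) = N"
        using x jk by (auto simp: nbox_def tables_col_sum)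
    qed
    show "G ` {g \<in> nbox n s. (\<Sum>i<n. g i) = N}
            \<subseteq> {x \<in> tables N n. merge_cols j k x = merge_cols j k y}"
    proof (clarify, intro conjI)
      fix g assume g: "g \<in> nbox n s" and N: "N = (\<Sum>i<n. g i)"
      have le: "g i \<le> s i" if "i < n" for i using g that by (auto simp: nbox_def)
      show "merge_cols j k (G g) = merge_cols j k y"
        using le jk y s_out by (auto simp: merge_cols_def G_def fun_eq_iff s_def tables_outside not_less)
      have row: "(\<Sum>l<n. G g i l) = N" if "i < n" for i
      proof -
        have "(\<Sum>l\<in>{..<n} - {j, k}. G g i l) = (\<Sum>l\<in>{..<n} - {j, k}. y i l)"
          using that by (intro sum.cong) (auto simp: G_def)
        then have "(\<Sum>l<n. G g i l) = (\<Sum>l<n. y i l)"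
          using jk that le[OF that] by (simp add: sum_two_cols[of j n k] G_def s_def)
        then show ?thesis using y that by (simp add: tables_row_sum)
      qed
      have col: "(\<Sum>i<n. G g i l) = N" if "l < n" for l
      proof -
        consider "l = j" | "l = k" | "l \<noteq> j" "l \<noteq> k" by blast
        then show ?thesis
        proof cases
          case 1
          then show ?thesis by (simp add: G_def N)
        next
          case 2
          have "(\<Sum>i<n. G g i l) = (\<Sum>i<n. s i - g i)" using 2 jk by (simp add: G_def)
          also have "\<dots> = (\<Sum>i<n. s i) - (\<Sum>i<n. g i)" using le by (intro sum_subtractf_nat) auto
          finally show ?thesis using sum_s N by simp
        next
          case 3
          then show ?thesis using y that by (simp add: G_def tables_col_sum)
        qed
      qed
      show "G g \<in> tables (\<Sum>i<n. g i) n"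
        unfolding N[symmetric] tables_def using row col jk y
        by (auto simp: G_def tables_outside)
    qed
  qed
qed

text \<open>The entry \<open>x i k\<close> vanishes exactly when \<open>x i j\<close> is the whole
  row sum of the pair, so each row contributes the difference of two vanishing indicators.\<close>

lemma nonzeros_diff_eq_end_diff:
  assumes "finite I"
  shows "real (nonzeros I x j) - real (nonzeros I x k) = (\<Sum>i\<in>I. end_diff (x i j + x i k) (x i j))"
proof -
  have nz: "real (nonzeros I x l) = (\<Sum>i\<in>I. of_bool (x i l \<noteq> 0))" for l
    using assms by (simp add: nonzeros_def of_bool_def sum.If_cases Int_def)
  show ?thesis
    unfolding nz sum_subtractf[symmetric] by (intro sum.cong refl) (auto simp: end_diff_def)
qed

text \<open>The tables are partitioned into fibres of \<open>merge_cols\<close>. Each fibre is the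
  central slice of a box and has at least a \<open>1 / (2 * N + 1)\<close> share of it, so the tail
  bound for the box carries over with this polynomial loss.\<close>

lemma card_nonzeros_diff_ge:
  assumes jk: "j < n" "k < n" and I: "I \<subseteq> {..<n}" and r: "0 < r" "r \<le> real n"
  shows "real (card {x \<in> tables N n. \<bar>real (nonzeros I x j) - real (nonzeros I x k)\<bar> \<ge> r})
           \<le> 2 * real (2 * N + 1) * exp (- (r\<^sup>2 / (4 * real n))) * real (card (tables N n))"
    (is "real (card (?B (tables N n))) \<le> ?c * _")
proof (cases "j = k")
  case True
  then show ?thesis using r by simp
next
  case False
  have finI: "finite I" using I finite_subset by blast
  define fib where "fib = (\<lambda>m. {x \<in> tables N n. merge_cols j k x = m})"
  have split: "card A = (\<Sum>m\<in>merge_cols j k ` tables N n. card {x \<in> A. merge_cols j k x = m})"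
    if "A \<subseteq> tables N n" for A
    using sum.group[of A "merge_cols j k ` tables N n" "merge_cols j k" "\<lambda>_. 1 :: nat"] that
      finite_subset[OF that] by (simp add: image_mono)
  have fib_le: "real (card {x \<in> ?B (tables N n). merge_cols j k x = m}) \<le> ?c * real (card {x \<in> tables N n. merge_cols j k x = m})"
    if m_in: "m \<in> merge_cols j k ` tables N n" for m
  proof -
    from m_in obtain y where y: "y \<in> tables N n" and m: "m = merge_cols j k y" by blast
    define s where "s = (\<lambda>i. y i j + y i k)"
    let ?F = "\<lambda>x. \<lambda>i\<in>{..<n}. x i j"
    let ?T = "{g \<in> nbox n s. \<bar>\<Sum>i\<in>I. end_diff (s i) (g i)\<bar> \<ge> r}"
    have bij: "bij_betw ?F {x \<in> tables N n. merge_cols j k x = m} {g \<in> nbox n s. (\<Sum>i<n. g i) = N}"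
      unfolding m s_def using bij_betw_merge_cols_fibre[OF y jk False] .
    have s: "x i j + x i k = s i" if "merge_cols j k x = m" for x i
      using fun_cong[OF fun_cong[OF that[unfolded m], of i], of j] by (simp add: merge_cols_def s_def)
    have sum_s: "(\<Sum>i<n. s i) = 2 * N"
      using y jk by (simp add: s_def sum.distrib tables_col_sum)
    have "?F ` {x \<in> ?B (tables N n). merge_cols j k x = m} \<subseteq> ?T"
    proof clarify
      fix x
      assume x: "x \<in> tables N n" "r \<le> \<bar>real (nonzeros I x j) - real (nonzeros I x k)\<bar>" "m = merge_cols j k x"
      have "real (nonzeros I x j) - real (nonzeros I x k) = (\<Sum>i\<in>I. end_diff (s i) (?F x i))"
        unfolding nonzeros_diff_eq_end_diff[OF finI] s[OF x(3)[symmetric]]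
        using I by (intro sum.cong refl) auto
      moreover have "?F x \<in> nbox n s" using bij x by (auto simp: bij_betw_def)
      ultimately show "?F x \<in> nbox n s \<and> r \<le> \<bar>\<Sum>i\<in>I. end_diff (s i) (?F x i)\<bar>"
        using x(2) by simp
    qed
    moreover have "inj_on ?F {x \<in> ?B (tables N n). merge_cols j k x = m}"
      using bij by (auto simp: bij_betw_def intro: inj_on_subset)
    ultimately have "card {x \<in> ?B (tables N n). merge_cols j k x = m} \<le> card ?T"
      by (intro card_inj_on_le) auto
    then have "real (card {x \<in> ?B (tables N n). merge_cols j k x = m}) \<le> real (card ?T)" by simp
    also have "\<dots> \<le> 2 * real (card (nbox n s)) * exp (- (r\<^sup>2 / (4 * real n)))"
      using r I by (intro card_nbox_end_diff_tail) auto
    also have "\<dots> \<le> 2 * real ((2 * N + 1) * card {g \<in> nbox n s. (\<Sum>i<n. g i) = N}) * exp (- (r\<^sup>2 / (4 * real n)))"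
      by (intro mult_right_mono mult_left_mono of_nat_mono card_nbox_le_central_slice sum_s) auto
    finally show ?thesis
      using bij_betw_same_card[OF bij] by (simp add: algebra_simps)
  qed
  have "real (card (?B (tables N n))) = (\<Sum>m\<in>merge_cols j k ` tables N n. real (card {x \<in> ?B (tables N n). merge_cols j k x = m}))"
    by (subst split) auto
  also have "\<dots> \<le> (\<Sum>m\<in>merge_cols j k ` tables N n. ?c * real (card {x \<in> tables N n. merge_cols j k x = m}))"
    by (intro sum_mono fib_le)
  also have "\<dots> = ?c * real (card (tables N n))"
    by (subst split[of "tables N n"]) (auto simp: sum_distrib_left)
  finally show ?thesis .
qed

section \<open>Many tables in total, few sparse ones\<close>

definition half_sign :: "nat \<Rightarrow> nat \<Rightarrow> int" where
  "half_sign h j = (if j < h then 1 else if j < 2 * h then - 1 else 0)"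

text \<open>The indices \<open>j\<close> and \<open>j + h\<close> have the same residue modulo
  \<open>h\<close> and opposite signs.\<close>

lemma sum_half_sign:
  assumes "2 * h \<le> n"
  shows "(\<Sum>j<n. half_sign h j * f (j mod h)) = 0"
proof -
  let ?g = "\<lambda>j. half_sign h j * f (j mod h)"
  have "(\<Sum>j<n. ?g j) = (\<Sum>j\<in>{0..<h}. ?g j) + (\<Sum>j\<in>{h..<2*h}. ?g j) + (\<Sum>j\<in>{2*h..<n}. ?g j)"
  proof -
    have "sum ?g {0..<h} + sum ?g {h..<2 * h} = sum ?g {0..<2 * h}"
      by (rule sum.atLeastLessThan_concat) auto
    moreover have "sum ?g {0..<2 * h} + sum ?g {2 * h..<n} = sum ?g {0..<n}"
      using assms by (intro sum.atLeastLessThan_concat) auto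
    ultimately show ?thesis unfolding lessThan_atLeast0 by linarith
  qed
  also have "(\<Sum>j\<in>{0..<h}. ?g j) = (\<Sum>j\<in>{0..<h}. f j)"
    by (intro sum.cong) (auto simp: half_sign_def)
  also have "(\<Sum>j\<in>{h..<2*h}. ?g j) = (\<Sum>j\<in>{0..<h}. - f j)"
    by (rule sum.reindex_bij_witness[of _ "\<lambda>j. j + h" "\<lambda>j. j - h"])
       (auto simp: half_sign_def le_mod_geq)
  also have "(\<Sum>j\<in>{2*h..<n}. ?g j) = 0"
    by (intro sum.neutral) (auto simp: half_sign_def)
  finally show ?thesis by (simp add: sum_negf)
qed

text \<open>Adding \<open>+1, -1, -1, +1\<close> in the four copies of any set of cells of an \<open>h \<times> h\<close> square keeps the
  margins of the constant table \<open>C\<close>.\<close>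

lemma card_tables_ge:
  assumes "2 * h \<le> n" "C \<ge> 1"
  shows "2 ^ (h * h) \<le> card (tables (C * n) n)"
proof -
  define X where "X = (\<lambda>A i j. if i < n \<and> j < n
    then nat (int C + half_sign h i * half_sign h j * of_bool ((i mod h, j mod h) \<in> A)) else 0)"
  \<comment> \<open>The perturbation is at least -1 and \<open>C \<ge> 1\<close>, so the conversion
    \<open>nat\<close> loses nothing.\<close>
  have int_X: "int (X A i j) = int C + half_sign h i * half_sign h j * of_bool ((i mod h, j mod h) \<in> A)"
    if "i < n" "j < n" for A i j
    using that assms(2) by (auto simp: X_def half_sign_def)
  have "X A \<in> tables (C * n) n" for A
  proof -
    have "int (\<Sum>j<n. X A i j) = int (C * n)" if "i < n" for i
    proof -
      have "int (\<Sum>j<n. X A i j) = (\<Sum>j<n. int C + half_sign h i *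
          (half_sign h j * of_bool ((i mod h, j mod h) \<in> A)))"
        using that by (simp add: int_X mult.assoc)
      also have "\<dots> = int (C * n)"
        unfolding sum.distrib sum_distrib_left[symmetric]
        using sum_half_sign[OF assms(1), of "\<lambda>j. of_bool ((i mod h, j) \<in> A)"] by simp
      finally show ?thesis .
    qed
    moreover have "int (\<Sum>i<n. X A i j) = int (C * n)" if "j < n" for j
    proof -
      have "int (\<Sum>i<n. X A i j) = (\<Sum>i<n. int C + half_sign h j *
          (half_sign h i * of_bool ((i mod h, j mod h) \<in> A)))"
        using that by (simp add: int_X mult_ac)
      also have "\<dots> = int (C * n)"
        unfolding sum.distrib sum_distrib_left[symmetric]
        using sum_half_sign[OF assms(1), of "\<lambda>i. of_bool ((i, j mod h) \<in> A)"] by simp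
      finally show ?thesis .
    qed
    ultimately show ?thesis
      unfolding tables_def of_nat_eq_iff by (auto simp: X_def)
  qed
  moreover have "inj_on X (Pow ({..<h} \<times> {..<h}))"
  proof (rule inj_onI)
    fix A B assume AB: "A \<in> Pow ({..<h} \<times> {..<h})" "B \<in> Pow ({..<h} \<times> {..<h})" "X A = X B"
    \<comment> \<open>On the first copy of the square both signs are 1, so the entry is
      \<open>C + 1\<close> or \<open>C\<close> according to membership.\<close>
    have "(i, j) \<in> A \<longleftrightarrow> (i, j) \<in> B" if "i < h" "j < h" for i j
      using int_X[of i j A] int_X[of i j B] AB(3) that assms(1)
      by (auto simp: half_sign_def of_bool_def split: if_splits)
    then show "A = B" using AB by auto
  qed
  ultimately have "card (Pow ({..<h} \<times> {..<h})) \<le> card (tables (C * n) n)"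
    by (intro card_inj_on_le[of X]) auto
  then show ?thesis by (simp add: card_Pow)
qed

text \<open>A table is recovered from the triples (row, column, value) of its nonzero entries, and a
  set of at most \<open>t\<close> triples is the set of some list of length exactly
  \<open>t\<close>. Counting such lists gives the bound.\<close>

lemma card_sparse_tables_le:
  assumes "N > 0" "n > 0"
  shows "card {x \<in> tables N n. (\<Sum>j<n. nonzeros {..<n} x j) \<le> t} \<le> (n * n * (N + 1)) ^ t"
proof -
  define gr where "gr = (\<lambda>x :: nat \<Rightarrow> nat \<Rightarrow> nat. {(i, j, v). i < n \<and> j < n \<and> v = x i j \<and> v \<noteq> 0})"
  define U where "U = {..<n} \<times> {..<n} \<times> {..N}"
  let ?S = "{x \<in> tables N n. (\<Sum>j<n. nonzeros {..<n} x j) \<le> t}"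
  have finU: "finite U" by (simp add: U_def)
  have inj: "inj_on gr ?S"
  proof (rule inj_onI, intro ext)
    fix x y i j assume xy: "x \<in> ?S" "y \<in> ?S" "gr x = gr y"
    show "x i j = y i j"
    proof (cases "i < n \<and> j < n")
      case True
      have "(i, j, v) \<in> gr x \<longleftrightarrow> (i, j, v) \<in> gr y" for v using xy(3) by simp
      from this[of "x i j"] this[of "y i j"] show ?thesis using True by (auto simp: gr_def)
    next
      case False
      then show ?thesis using xy by (auto simp: tables_outside)
    qed
  qed
  have "gr ` ?S \<subseteq> set ` {xs. set xs \<subseteq> U \<and> length xs = t}"
  proof clarify
    fix x assume x: "x \<in> tables N n" and t: "(\<Sum>j<n. nonzeros {..<n} x j) \<le> t"
    have sub: "gr x \<subseteq> U" using tables_le[OF x] by (auto simp: gr_def U_def)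
    let ?P = "SIGMA j:{..<n}. {i \<in> {..<n}. x i j \<noteq> 0}"
    have "gr x = (\<lambda>(j, i). (i, j, x i j)) ` ?P"
      by (auto simp: gr_def image_iff)
    moreover have "card ((\<lambda>(j, i). (i, j, x i j)) ` ?P) \<le> card ?P"
      by (intro card_image_le) auto
    moreover have "card ?P = (\<Sum>j<n. nonzeros {..<n} x j)"
      unfolding nonzeros_def by (rule card_SigmaI) auto
    ultimately have card: "card (gr x) \<le> t" using t by simp
    \<comment> \<open>A nonzero entry is needed because short lists are padded by repeating their
      head; it exists as the row sum \<open>N\<close> is positive.\<close>
    have "\<exists>j<n. x 0 j \<noteq> 0"
    proof (rule ccontr)
      assume "\<not> (\<exists>j<n. x 0 j \<noteq> 0)"
      then have "(\<Sum>j<n. x 0 j) = 0" by simp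
      then show False using tables_row_sum[OF x assms(2)] assms(1) by simp
    qed
    then have "gr x \<noteq> {}" using assms(2) by (auto simp: gr_def)
    moreover obtain xs where xs: "set xs = gr x" "length xs = card (gr x)"
      using finite_distinct_list[OF finite_subset[OF sub finU]] distinct_card by metis
    ultimately have "xs \<noteq> []" by auto
    then have "set (xs @ replicate (t - length xs) (hd xs)) = set xs"
      by (simp add: set_replicate_conv_if insert_absorb)
    moreover have "length (xs @ replicate (t - length xs) (hd xs)) = t" using xs card by simp
    ultimately show "gr x \<in> set ` {xs. set xs \<subseteq> U \<and> length xs = t}"
      using sub xs(1) by (intro image_eqI[of _ _ "xs @ replicate (t - length xs) (hd xs)"]) simp_all
  qed
  then have "card (gr ` ?S) \<le> card (set ` {xs. set xs \<subseteq> U \<and> length xs = t})"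
    by (intro card_mono finite_imageI finite_lists_length_eq finU)
  also have "\<dots> \<le> card {xs. set xs \<subseteq> U \<and> length xs = t}"
    by (intro card_image_le finite_lists_length_eq finU)
  also have "\<dots> = card U ^ t" by (rule card_lists_length_eq[OF finU])
  finally show ?thesis
    by (simp add: card_image[OF inj] U_def algebra_simps)
qed

section \<open>Switchings\<close>

text \<open>Subtraction is truncated here, so margins are kept only when both decreased entries are
  positive and the rows and the columns are distinct.\<close>

definition switch :: "nat \<Rightarrow> nat \<Rightarrow> nat \<Rightarrow> nat \<Rightarrow> (nat \<Rightarrow> nat \<Rightarrow> nat) \<Rightarrow> nat \<Rightarrow> nat \<Rightarrow> nat" where
  "switch a b i j x = (\<lambda>k l.
     if (k, l) = (a, b) \<or> (k, l) = (i, j) then x k l - 1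
     else if (k, l) = (a, j) \<or> (k, l) = (i, b) then x k l + 1 else x k l)"

lemma sum_move_unit:
  fixes f :: "nat \<Rightarrow> nat"
  assumes "b < n" "j < n" "b \<noteq> j" "f b \<ge> 1"
  shows "(\<Sum>l<n. if l = b then f l - 1 else if l = j then f l + 1 else f l) = (\<Sum>l<n. f l)"
proof -
  have "(\<Sum>l\<in>{..<n} - {b, j}. if l = b then f l - 1 else if l = j then f l + 1 else f l)
      = (\<Sum>l\<in>{..<n} - {b, j}. f l)"
    by (intro sum.cong) auto
  then show ?thesis using assms by (simp add: sum_two_cols[of b n j])
qed

lemma switch_in_tables:
  assumes x: "x \<in> tables N n" and "a < n" "b < n" "i < n" "j < n" "a \<noteq> i" "b \<noteq> j"
    and pos: "x a b \<ge> 1" "x i j \<ge> 1"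
  shows "switch a b i j x \<in> tables N n"
proof -
  let ?y = "switch a b i j x"
  have "(\<Sum>l<n. ?y k l) = (\<Sum>l<n. x k l)" for k
  proof -
    consider "k = a" | "k = i" | "k \<noteq> a" "k \<noteq> i" by blast
    then show ?thesis
    proof cases
      case 1
      then have "?y k = (\<lambda>l. if l = b then x k l - 1 else if l = j then x k l + 1 else x k l)"
        using assms by (auto simp: switch_def)
      then show ?thesis using assms 1 sum_move_unit[of b n j "x a"] by metis
    next
      case 2
      then have "?y k = (\<lambda>l. if l = j then x k l - 1 else if l = b then x k l + 1 else x k l)"
        using assms by (auto simp: switch_def)
      then show ?thesis using assms 2 sum_move_unit[of j n b "x i"] by metis
    qed (simp add: switch_def)
  qed
  moreover have "(\<Sum>k<n. ?y k l) = (\<Sum>k<n. x k l)" for l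
  proof -
    consider "l = b" | "l = j" | "l \<noteq> b" "l \<noteq> j" by blast
    then show ?thesis
    proof cases
      case 1
      then have "(\<lambda>k. ?y k l) = (\<lambda>k. if k = a then x k l - 1 else if k = i then x k l + 1 else x k l)"
        using assms by (auto simp: switch_def)
      then show ?thesis using assms 1 sum_move_unit[of a n i "\<lambda>k. x k l"] by metis
    next
      case 2
      then have "(\<lambda>k. ?y k l) = (\<lambda>k. if k = i then x k l - 1 else if k = a then x k l + 1 else x k l)"
        using assms by (auto simp: switch_def)
      then show ?thesis using assms 2 sum_move_unit[of i n a "\<lambda>k. x k l"] by metis
    qed (simp add: switch_def)
  qed
  moreover have "?y k l = 0" if "k \<ge> n \<or> l \<ge> n" for k l
    using that assms by (auto simp: switch_def tables_outside)
  ultimately show ?thesis using x by (simp add: tables_def)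
qed

text \<open>Exchanging the roles of the columns \<open>b\<close> and \<open>j\<close> undoes the
  switching.\<close>

lemma switch_switch:
  assumes "a \<noteq> i" "b \<noteq> j" "x a b \<ge> 1" "x i j \<ge> 1"
  shows "switch a j i b (switch a b i j x) = x"
  using assms by (auto simp: switch_def fun_eq_iff)

text \<open>Double counting: for fixed \<open>i\<close> and \<open>j\<close> the switching is a
  bijection from the tables positive at \<open>(a, b)\<close> and \<open>(i, j)\<close> onto those
  positive at \<open>(a, j)\<close> and \<open>(i, b)\<close>, so the weight of a pair can be
  charged to either end.\<close>

lemma sum_tables_switch:
  fixes w :: "(nat \<Rightarrow> nat \<Rightarrow> nat) \<Rightarrow> nat \<Rightarrow> nat \<Rightarrow> real"
  assumes "a < n" "b < n" "I \<subseteq> {..<n}" "J \<subseteq> {..<n}" "a \<notin> I" "b \<notin> J"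
  shows "(\<Sum>x\<in>tables N n. \<Sum>j\<in>J. \<Sum>i\<in>I. of_bool (x a b \<ge> 1 \<and> x i j \<ge> 1) * w x i j)
       = (\<Sum>x\<in>tables N n. \<Sum>j\<in>J. \<Sum>i\<in>I. of_bool (x a j \<ge> 1 \<and> x i b \<ge> 1) * w (switch a j i b x) i j)"
proof -
  have eq: "(\<Sum>x\<in>tables N n. of_bool (x a b \<ge> 1 \<and> x i j \<ge> 1) * w x i j)
      = (\<Sum>x\<in>tables N n. of_bool (x a j \<ge> 1 \<and> x i b \<ge> 1) * w (switch a j i b x) i j)"
    if "i \<in> I" "j \<in> J" for i j
  proof -
    have ij: "i < n" "j < n" "a \<noteq> i" "b \<noteq> j" using that assms by auto
    have "(\<Sum>x\<in>tables N n. of_bool (x a b \<ge> 1 \<and> x i j \<ge> 1) * w x i j)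
        = (\<Sum>x\<in>{x \<in> tables N n. x a b \<ge> 1 \<and> x i j \<ge> 1}. w x i j)"
      by (intro sum.mono_neutral_cong_right) auto
    also have "\<dots> = (\<Sum>x\<in>{x \<in> tables N n. x a j \<ge> 1 \<and> x i b \<ge> 1}. w (switch a j i b x) i j)"
    proof (rule sum.reindex_bij_witness[of _ "switch a j i b" "switch a b i j"])
      fix x assume "x \<in> {x \<in> tables N n. x a b \<ge> 1 \<and> x i j \<ge> 1}"
      then have x: "x \<in> tables N n" "x a b \<ge> 1" "x i j \<ge> 1" by auto
      show inv: "switch a j i b (switch a b i j x) = x"
        using x ij by (intro switch_switch)
      show "w (switch a j i b (switch a b i j x)) i j = w x i j" by (simp add: inv)
      show "switch a b i j x \<in> {x \<in> tables N n. x a j \<ge> 1 \<and> x i b \<ge> 1}"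
        using switch_in_tables[OF x(1) assms(1,2) ij x(2,3)] ij by (auto simp: switch_def)
    next
      fix x assume "x \<in> {x \<in> tables N n. x a j \<ge> 1 \<and> x i b \<ge> 1}"
      then have x: "x \<in> tables N n" "x a j \<ge> 1" "x i b \<ge> 1" by auto
      show "switch a b i j (switch a j i b x) = x"
        using x ij by (intro switch_switch) auto
      show "switch a j i b x \<in> {x \<in> tables N n. x a b \<ge> 1 \<and> x i j \<ge> 1}"
        using switch_in_tables[OF x(1) assms(1) ij(2,1) assms(2) ij(3) ij(4)[symmetric] x(2,3)] ij
        by (auto simp: switch_def)
    qed
    also have "\<dots> = (\<Sum>x\<in>tables N n. of_bool (x a j \<ge> 1 \<and> x i b \<ge> 1) * w (switch a j i b x) i j)"
      by (intro sum.mono_neutral_cong_left) auto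
    finally show ?thesis .
  qed
  have "(\<Sum>j\<in>J. \<Sum>i\<in>I. \<Sum>x\<in>tables N n. of_bool (x a b \<ge> 1 \<and> x i j \<ge> 1) * w x i j)
       = (\<Sum>j\<in>J. \<Sum>i\<in>I. \<Sum>x\<in>tables N n. of_bool (x a j \<ge> 1 \<and> x i b \<ge> 1) * w (switch a j i b x) i j)"
    by (intro sum.cong refl eq; assumption)
  then show ?thesis
    by (simp only: sum.swap[of _ "tables N n"])
qed

text \<open>As row \<open>a\<close> is not counted, the only counted cell of column \<open>j\<close>
  that changes is \<open>(i, j)\<close>, which gains one unit.\<close>

lemma nonzeros_switch:
  assumes "finite I" "i \<in> I" "a \<notin> I" "b \<noteq> j"
  shows "nonzeros I (switch a j i b x) j = nonzeros I x j + of_bool (x i j = 0)"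
proof -
  have "{k \<in> I. switch a j i b x k j \<noteq> 0} = insert i {k \<in> I. x k j \<noteq> 0}"
    using assms by (auto simp: switch_def)
  then show ?thesis using assms by (auto simp: nonzeros_def card_insert_if)
qed

lemma of_bool_sum_nonzeros:
  assumes "finite I"
  shows "(\<Sum>i\<in>I. of_bool (x i j \<ge> 1) * c) = real (nonzeros I x j) * c"
proof -
  have "(\<Sum>i\<in>I. of_bool (x i j \<ge> 1) * c) = (\<Sum>i\<in>{i \<in> I. x i j \<noteq> 0}. c)"
    using assms by (intro sum.mono_neutral_cong_right) (auto simp: Suc_le_eq)
  then show ?thesis by (simp add: nonzeros_def)
qed

text \<open>The weight \<open>\<phi> x * (x a j + 1) / nonzeros I x j\<close> makes the forward sum over \<open>i\<close> collapse exactly;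
  in the backward sum it leaves the factor \<open>\<kappa>\<close>, which is close to 1 on \<open>G\<close>.\<close>

lemma switching_estimate:
  fixes \<phi> \<psi> :: "(nat \<Rightarrow> nat \<Rightarrow> nat) \<Rightarrow> real"
  assumes ab: "a < n" "b < n" and IJ: "I \<subseteq> {..<n}" "J \<subseteq> {..<n}" "a \<notin> I" "b \<notin> J"
    and \<phi>_zero: "\<And>x. x \<in> tables N n \<Longrightarrow> x a b = 0 \<Longrightarrow> \<phi> x = 0"
    and \<phi>_switch: "\<And>x i j. \<lbrakk>x \<in> tables N n; i \<in> I; j \<in> J; x a j \<ge> 1; x i b \<ge> 1\<rbrakk>
       \<Longrightarrow> \<phi> (switch a j i b x) = \<psi> x"
    and \<phi>_bounds: "\<And>x. x \<in> tables N n \<Longrightarrow> 0 \<le> \<phi> x \<and> \<phi> x \<le> K"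
    and \<psi>_bounds: "\<And>x. x \<in> tables N n \<Longrightarrow> 0 \<le> \<psi> x \<and> \<psi> x \<le> K"
    and G: "G \<subseteq> tables N n"
    and \<delta>: "0 \<le> \<delta>"
    and good: "\<And>x j. x \<in> G \<Longrightarrow> j \<in> J \<Longrightarrow> nonzeros I x j > 0 \<and>
       \<bar>real (nonzeros I x j) - real (nonzeros I x b)\<bar> + 1 \<le> \<delta> * real (nonzeros I x j)"
  shows "\<bar>(\<Sum>x\<in>tables N n. \<phi> x * (\<Sum>j\<in>J. real (x a j) + 1))
            - (\<Sum>x\<in>tables N n. \<psi> x * (\<Sum>j\<in>J. real (x a j)))\<bar>
         \<le> \<delta> * (\<Sum>x\<in>tables N n. \<psi> x * (\<Sum>j\<in>J. real (x a j)))
            + real (card (tables N n - G)) * (K * (real n + real N + real N * real n))"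
proof -
  let ?T = "tables N n" and ?\<nu> = "nonzeros I"
  have fin: "finite I" "finite J" using IJ finite_subset by blast+
  define Z where "Z = (\<lambda>x :: nat \<Rightarrow> nat \<Rightarrow> nat. \<Sum>j\<in>J. real (x a j))"
  define \<kappa> where "\<kappa> = (\<lambda>x j. \<Sum>i\<in>I. of_bool (x i b \<ge> 1) / real (?\<nu> (switch a j i b x) j))"
  define w where "w = (\<lambda>x (i :: nat) j. \<phi> x * (real (x a j) + 1) / real (?\<nu> x j))"
  have Z: "0 \<le> Z x" "Z x \<le> real N" if "x \<in> ?T" for x
  proof -
    show "0 \<le> Z x" by (auto simp: Z_def intro: sum_nonneg)
    have "Z x \<le> (\<Sum>j<n. real (x a j))"
      unfolding Z_def using IJ by (intro sum_mono2) auto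
    also have "\<dots> = real N" using tables_row_sum[OF that ab(1)] by (simp flip: of_nat_sum)
    finally show "Z x \<le> real N" .
  qed
  have Z1: "(\<Sum>j\<in>J. real (x a j) + 1) = Z x + real (card J)" for x
    by (simp add: Z_def sum.distrib)
  have J: "real (card J) \<le> real n" using IJ(2) card_mono[of "{..<n}" J] by simp

  have "(\<Sum>x\<in>?T. \<phi> x * (\<Sum>j\<in>J. of_bool (?\<nu> x j > 0) * (real (x a j) + 1)))
      = (\<Sum>x\<in>?T. \<Sum>j\<in>J. \<Sum>i\<in>I. of_bool (x a b \<ge> 1 \<and> x i j \<ge> 1) * w x i j)"
  proof (intro sum.cong refl)
    fix x assume x: "x \<in> ?T"
    have "(\<Sum>i\<in>I. of_bool (x a b \<ge> 1 \<and> x i j \<ge> 1) * w x i j)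
        = \<phi> x * (of_bool (?\<nu> x j > 0) * (real (x a j) + 1))" for j
    proof (cases "x a b = 0")
      case True
      then show ?thesis using \<phi>_zero[OF x] by simp
    next
      case False
      \<comment> \<open>The weight \<open>w\<close> ignores its row argument, so row 0 stands for
        every row.\<close>
      then have eq: "(\<Sum>i\<in>I. of_bool (x a b \<ge> 1 \<and> x i j \<ge> 1) * w x i j) = (\<Sum>i\<in>I. of_bool (x i j \<ge> 1) * w x 0 j)"
        by (intro sum.cong) (auto simp: w_def)
      show ?thesis unfolding eq of_bool_sum_nonzeros[OF fin(1)] by (simp add: w_def)
    qed
    then show "\<phi> x * (\<Sum>j\<in>J. of_bool (?\<nu> x j > 0) * (real (x a j) + 1))
        = (\<Sum>j\<in>J. \<Sum>i\<in>I. of_bool (x a b \<ge> 1 \<and> x i j \<ge> 1) * w x i j)"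
      by (simp add: sum_distrib_left)
  qed
  also have "\<dots> = (\<Sum>x\<in>?T. \<Sum>j\<in>J. \<Sum>i\<in>I. of_bool (x a j \<ge> 1 \<and> x i b \<ge> 1) * w (switch a j i b x) i j)"
    by (rule sum_tables_switch[OF ab IJ])
  also have "\<dots> = (\<Sum>x\<in>?T. \<psi> x * (\<Sum>j\<in>J. real (x a j) * \<kappa> x j))"
  proof (intro sum.cong refl)
    fix x assume x: "x \<in> ?T"
    have "of_bool (x a j \<ge> 1 \<and> x i b \<ge> 1) * w (switch a j i b x) i j
        = \<psi> x * (real (x a j) * (of_bool (x i b \<ge> 1) / real (?\<nu> (switch a j i b x) j)))"
      if "i \<in> I" "j \<in> J" for i j
    proof (cases "x a j \<ge> 1 \<and> x i b \<ge> 1")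
      case True
      \<comment> \<open>Switching lowers \<open>x a j\<close> by one, which turns the factor
        \<open>x a j + 1\<close> of the weight into \<open>x a j\<close>.\<close>
      then have "real (switch a j i b x a j) + 1 = real (x a j)"
        by (simp add: switch_def of_nat_diff)
      then show ?thesis using True \<phi>_switch[OF x that] by (simp add: w_def)
    next
      case False
      then show ?thesis by (cases "x a j = 0") auto
    qed
    then show "(\<Sum>j\<in>J. \<Sum>i\<in>I. of_bool (x a j \<ge> 1 \<and> x i b \<ge> 1) * w (switch a j i b x) i j)
        = \<psi> x * (\<Sum>j\<in>J. real (x a j) * \<kappa> x j)"
      by (simp add: \<kappa>_def sum_distrib_left)
  qed
  finally have identity: "(\<Sum>x\<in>?T. \<phi> x * (\<Sum>j\<in>J. of_bool (?\<nu> x j > 0) * (real (x a j) + 1)))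
      = (\<Sum>x\<in>?T. \<psi> x * (\<Sum>j\<in>J. real (x a j) * \<kappa> x j))" .

  \<comment> \<open>The denominators in \<open>\<kappa> x j\<close> are \<open>?\<nu> x j\<close> or
    one more, while \<open>?\<nu> x b\<close> terms are nonzero; so \<open>\<kappa> x j\<close> lies
    between \<open>?\<nu> x b / (?\<nu> x j + 1)\<close> and \<open>?\<nu> x b / ?\<nu> x j\<close>.
    The \<open>+ 1\<close> in the hypothesis \<open>good\<close> covers this ambiguity.\<close>
  have \<kappa>_good: "\<bar>\<kappa> x j - 1\<bar> \<le> \<delta>" if x: "x \<in> G" and j: "j \<in> J" for x j
  proof -
    have pos: "real (?\<nu> x j) > 0" and
      close: "\<bar>real (?\<nu> x j) - real (?\<nu> x b)\<bar> + 1 \<le> \<delta> * real (?\<nu> x j)"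
      using good[OF x j] by auto
    have bj: "b \<noteq> j" using j IJ by auto
    have "\<kappa> x j \<le> (\<Sum>i\<in>I. of_bool (x i b \<ge> 1) * (1 / real (?\<nu> x j)))"
      unfolding \<kappa>_def using pos by (intro sum_mono)
        (auto simp: nonzeros_switch[OF fin(1) _ IJ(3) bj] field_simps)
    also have "\<dots> = real (?\<nu> x b) / real (?\<nu> x j)"
      by (subst of_bool_sum_nonzeros[OF fin(1)]) simp
    also have "\<dots> \<le> 1 + \<delta>"
      using close pos by (simp add: field_simps)
    finally have up: "\<kappa> x j \<le> 1 + \<delta>" .
    have "real (?\<nu> x b) \<ge> (1 - \<delta>) * (real (?\<nu> x j) + 1)"
      using close \<delta> by (simp add: algebra_simps)
    then have "1 - \<delta> \<le> real (?\<nu> x b) / (real (?\<nu> x j) + 1)"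
      by (simp add: field_simps)
    also have "\<dots> = (\<Sum>i\<in>I. of_bool (x i b \<ge> 1) * (1 / (real (?\<nu> x j) + 1)))"
      by (subst of_bool_sum_nonzeros[OF fin(1)]) simp
    also have "\<dots> \<le> \<kappa> x j"
      unfolding \<kappa>_def using pos by (intro sum_mono)
        (auto simp: nonzeros_switch[OF fin(1) _ IJ(3) bj] field_simps)
    finally show ?thesis using up by linarith
  qed
  have \<kappa>_crude: "\<bar>\<kappa> x j - 1\<bar> \<le> real n" for x j
  proof -
    have "\<kappa> x j \<le> (\<Sum>i\<in>I. 1)"
      unfolding \<kappa>_def by (intro sum_mono) (auto simp: divide_le_eq_1)
    also have "\<dots> \<le> real n" using IJ(1) card_mono[of "{..<n}" I] by simp
    finally have "\<kappa> x j \<le> real n" .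
    moreover have "0 \<le> \<kappa> x j" unfolding \<kappa>_def by (intro sum_nonneg) auto
    moreover have "1 \<le> real n" using ab by simp
    ultimately show ?thesis by linarith
  qed

  let ?L = "\<lambda>x. \<Sum>j\<in>J. of_bool (?\<nu> x j > 0) * (real (x a j) + 1)"
  let ?M = "\<lambda>x. \<Sum>j\<in>J. real (x a j) * \<kappa> x j"
  let ?b = "\<lambda>x. of_bool (x \<notin> G) :: real"
  \<comment> \<open>Columns without nonzero entries in the rows \<open>I\<close> drop out of
    \<open>?L\<close>; on \<open>G\<close> there are none, and off \<open>G\<close> the loss is
    bounded crudely.\<close>
  have left: "\<bar>\<phi> x * (Z x + real (card J)) - \<phi> x * ?L x\<bar> \<le> ?b x * (K * (real n + real N))"
    if x: "x \<in> ?T" for x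
  proof (cases "x \<in> G")
    case True
    then have "?L x = (\<Sum>j\<in>J. real (x a j) + 1)"
      using good by (intro sum.cong) auto
    then show ?thesis using True by (simp add: Z1)
  next
    case False
    have "0 \<le> ?L x" by (intro sum_nonneg) auto
    moreover have "?L x \<le> (\<Sum>j\<in>J. real (x a j) + 1)" by (intro sum_mono) auto
    ultimately have "\<bar>(Z x + real (card J)) - ?L x\<bar> \<le> real n + real N"
      using Z[OF x] J unfolding Z1 by linarith
    then have "\<bar>\<phi> x\<bar> * \<bar>(Z x + real (card J)) - ?L x\<bar> \<le> K * (real n + real N)"
      using \<phi>_bounds[OF x] by (intro mult_mono) auto
    then show ?thesis using False by (simp add: abs_mult[symmetric] right_diff_distrib)
  qed
  have right: "\<bar>\<psi> x * ?M x - \<psi> x * Z x\<bar> \<le> \<delta> * (\<psi> x * Z x) + ?b x * (K * (real N * real n))"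
    if x: "x \<in> ?T" for x
  proof -
    have diff: "\<bar>?M x - Z x\<bar> \<le> c * Z x" if "\<And>j. j \<in> J \<Longrightarrow> \<bar>\<kappa> x j - 1\<bar> \<le> c" for c
    proof -
      have "\<bar>?M x - Z x\<bar> = \<bar>\<Sum>j\<in>J. real (x a j) * (\<kappa> x j - 1)\<bar>"
        by (simp add: Z_def sum_subtractf[symmetric] right_diff_distrib)
      also have "\<dots> \<le> (\<Sum>j\<in>J. real (x a j) * c)"
        by (intro order.trans[OF sum_abs] sum_mono) (auto simp: abs_mult intro: mult_left_mono that)
      finally show ?thesis by (simp add: Z_def sum_distrib_left mult_ac)
    qed
    have eq: "\<bar>\<psi> x * ?M x - \<psi> x * Z x\<bar> = \<psi> x * \<bar>?M x - Z x\<bar>"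
      using \<psi>_bounds[OF x] by (simp add: abs_mult flip: right_diff_distrib)
    show ?thesis
    proof (cases "x \<in> G")
      case True
      then have "\<psi> x * \<bar>?M x - Z x\<bar> \<le> \<psi> x * (\<delta> * Z x)"
        using \<psi>_bounds[OF x] \<kappa>_good by (intro mult_left_mono diff) auto
      then show ?thesis using True eq by (simp add: mult_ac)
    next
      case False
      have "\<bar>?M x - Z x\<bar> \<le> real n * Z x" using \<kappa>_crude by (intro diff) auto
      also have "\<dots> \<le> real n * real N" using Z[OF x] by (intro mult_left_mono) auto
      finally have "\<psi> x * \<bar>?M x - Z x\<bar> \<le> K * (real n * real N)"
        using \<psi>_bounds[OF x] by (intro mult_mono) auto
      moreover have "0 \<le> \<delta> * (\<psi> x * Z x)"
        using \<delta> \<psi>_bounds[OF x] Z[OF x] by simp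
      ultimately show ?thesis using False eq by (simp add: mult_ac)
    qed
  qed

  have b_sum: "(\<Sum>x\<in>?T. ?b x * c) = real (card (?T - G)) * c" for c
  proof -
    have "(\<Sum>x\<in>?T. ?b x * c) = (\<Sum>x\<in>?T - G. c)"
      by (intro sum.mono_neutral_cong_right) auto
    then show ?thesis by simp
  qed
  let ?A = "\<Sum>x\<in>?T. \<phi> x * (Z x + real (card J))" and ?B = "\<Sum>x\<in>?T. \<psi> x * Z x"
  have "\<bar>?A - (\<Sum>x\<in>?T. \<phi> x * ?L x)\<bar> \<le> (\<Sum>x\<in>?T. ?b x * (K * (real n + real N)))"
    unfolding sum_subtractf[symmetric]
    by (intro order.trans[OF sum_abs] sum_mono left)
  then have 1: "\<bar>?A - (\<Sum>x\<in>?T. \<phi> x * ?L x)\<bar> \<le> real (card (?T - G)) * (K * (real n + real N))"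
    unfolding b_sum .
  have "\<bar>(\<Sum>x\<in>?T. \<psi> x * ?M x) - ?B\<bar> \<le> (\<Sum>x\<in>?T. \<delta> * (\<psi> x * Z x) + ?b x * (K * (real N * real n)))"
    unfolding sum_subtractf[symmetric]
    by (intro order.trans[OF sum_abs] sum_mono right)
  then have 2: "\<bar>(\<Sum>x\<in>?T. \<psi> x * ?M x) - ?B\<bar> \<le> \<delta> * ?B + real (card (?T - G)) * (K * (real N * real n))"
    unfolding sum.distrib b_sum sum_distrib_left[symmetric] .
  have "\<bar>?A - ?B\<bar> \<le> \<delta> * ?B + (real (card (?T - G)) * (K * (real n + real N))
      + real (card (?T - G)) * (K * (real N * real n)))"
    using 1 2 identity by linarith
  then show ?thesis unfolding Z1 by (simp add: Z_def algebra_simps)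
qed

section \<open>Asymptotics of averages over tables\<close>

text \<open>The exponent 3/4 exceeds 1/2, which makes the tail bound superpolynomially small, and is
  below 7/8, which makes the column ratios tend to 1. As 7/8 is below 1, tables violating the second
  condition have only about \<open>n powr (15/8)\<close> nonzero entries, too few for them to be
  frequent.\<close>

definition good_tables :: "nat \<Rightarrow> nat \<Rightarrow> nat set \<Rightarrow> (nat \<Rightarrow> nat \<Rightarrow> nat) set" where
  "good_tables N n R = {x \<in> tables N n.
     (\<forall>j<n. \<forall>k<n. \<bar>real (nonzeros ({..<n} - R) x j) - real (nonzeros ({..<n} - R) x k)\<bar> < real n powr (3/4)) \<and>
     (\<exists>j<n. real n powr (7/8) \<le> real (nonzeros {..<n} x j))}"

text \<open>A union bound over pairs of columns handles the first condition. If the second one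
  fails, the table is sparse, and the number of sparse tables is compared with the lower bound
  \<open>2 ^ (h * h)\<close> for all tables.\<close>

lemma card_bad_tables_le:
  assumes "C \<ge> 1"
  shows "\<forall>\<^sub>F n in sequentially. real (card (tables (C * n) n - good_tables (C * n) n R))
           \<le> (4 * real C + 3) * exp (- sqrt (real n) / 8) * real (card (tables (C * n) n))"
proof -
  have "\<forall>\<^sub>F n::nat in sequentially. real n ^ 3 * exp (- sqrt (real n) / 4) \<le> exp (- sqrt (real n) / 8)"
    by real_asymp
  moreover have "\<forall>\<^sub>F n::nat in sequentially. exp (4 * ln (real n) * real n powr (15/8) - ln 2 * ((real n - 1) / 2)\<^sup>2)
      \<le> exp (- sqrt (real n) / 8)"
    by real_asymp
  moreover have "\<forall>\<^sub>F n in sequentially. n \<ge> C + 1"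
    by (rule eventually_ge_at_top)
  ultimately show ?thesis
  proof eventually_elim
    case (elim n)
    note asymp1 = elim(1) and asymp2 = elim(2)
    define T where "T = tables (C * n) n"
    define r where "r = real n powr (3/4)"
    define t where "t = nat \<lfloor>real n powr (15/8)\<rfloor>"
    define h where "h = n div 2"
    let ?I = "{..<n} - R"
    define D where "D = (\<lambda>j k. {x \<in> T. \<bar>real (nonzeros ?I x j) - real (nonzeros ?I x k)\<bar> \<ge> r})"
    define Sp where "Sp = {x \<in> T. (\<Sum>j<n. nonzeros {..<n} x j) \<le> t}"
    have n: "n > 0" "real n \<ge> 1" using elim(3) by auto
    have r: "0 < r" "r \<le> real n"
      using n powr_mono[of "3/4" 1 "real n"] by (auto simp: r_def)
    have r2: "r\<^sup>2 / (4 * real n) = sqrt (real n) / 4"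
    proof -
      have "r\<^sup>2 = real n powr 1 * real n powr (1/2)"
        unfolding r_def power2_eq_square powr_add[symmetric] by simp
      also have "\<dots> = real n * sqrt (real n)" using n(2) by (simp add: powr_half_sqrt)
      finally show ?thesis using n by simp
    qed
    have "T - good_tables (C * n) n R \<subseteq> (\<Union>j<n. \<Union>k<n. D j k) \<union> Sp"
    proof
      fix x assume x: "x \<in> T - good_tables (C * n) n R"
      show "x \<in> (\<Union>j<n. \<Union>k<n. D j k) \<union> Sp"
      proof (cases "\<exists>j<n. \<exists>k<n. x \<in> D j k")
        case False
        then have "\<forall>j<n. \<forall>k<n. \<bar>real (nonzeros ?I x j) - real (nonzeros ?I x k)\<bar> < r"
          using x unfolding D_def by force
        then have "\<not> (\<exists>j<n. real n powr (7/8) \<le> real (nonzeros {..<n} x j))"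
          using x unfolding good_tables_def T_def r_def by blast
        then have small: "real (nonzeros {..<n} x j) \<le> real n powr (7/8)" if "j < n" for j
          using that by (meson linear)
        have "real (\<Sum>j<n. nonzeros {..<n} x j) \<le> (\<Sum>j<n. real n powr (7/8))"
          unfolding of_nat_sum using small by (intro sum_mono) blast
        also have "\<dots> = real n powr 1 * real n powr (7/8)" by simp
        also have "\<dots> = real n powr (15/8)" unfolding powr_add[symmetric] by simp
        finally have "(\<Sum>j<n. nonzeros {..<n} x j) \<le> t"
          unfolding t_def by (rule le_nat_floor)
        then show ?thesis using x by (simp add: Sp_def)
      qed auto
    qed
    then have "card (T - good_tables (C * n) n R) \<le> card ((\<Union>j<n. \<Union>k<n. D j k) \<union> Sp)"
      by (intro card_mono) (auto simp: D_def Sp_def T_def)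
    also have "\<dots> \<le> (\<Sum>j<n. \<Sum>k<n. card (D j k)) + card Sp"
      by (intro order.trans[OF card_Un_le] add_mono order.trans[OF card_UN_le] sum_mono) auto
    finally have "real (card (T - good_tables (C * n) n R)) \<le> (\<Sum>j<n. \<Sum>k<n. real (card (D j k))) + real (card Sp)"
      by (simp flip: of_nat_sum of_nat_add)
    also have "(\<Sum>j<n. \<Sum>k<n. real (card (D j k))) \<le>
       (\<Sum>j<n. \<Sum>k<n. 2 * real (2 * (C * n) + 1) * exp (- sqrt (real n) / 4) * real (card T))"
      unfolding D_def T_def using r
      by (intro sum_mono order.trans[OF card_nonzeros_diff_ge]) (auto simp: r2)
    also have "\<dots> = real n ^ 2 * (2 * real (2 * (C * n) + 1)) * exp (- sqrt (real n) / 4) * real (card T)"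
      by (simp add: power2_eq_square)
    also have "\<dots> \<le> real n ^ 2 * ((4 * real C + 2) * real n) * exp (- sqrt (real n) / 4) * real (card T)"
      using n by (intro mult_right_mono mult_left_mono) (auto simp: algebra_simps)
    also have "\<dots> = (4 * real C + 2) * real (card T) * (real n ^ 3 * exp (- sqrt (real n) / 4))"
      by (simp add: power2_eq_square power3_eq_cube)
    also have "\<dots> \<le> (4 * real C + 2) * real (card T) * exp (- sqrt (real n) / 8)"
      by (intro mult_left_mono asymp1) auto
    finally have "real (card (T - good_tables (C * n) n R))
        \<le> (4 * real C + 2) * real (card T) * exp (- sqrt (real n) / 8) + real (card Sp)" by simp
    moreover have "real (card Sp) \<le> exp (- sqrt (real n) / 8) * real (card T)"
    proof -
      have "card Sp \<le> (n * n * (C * n + 1)) ^ t"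
        unfolding Sp_def T_def using assms n by (intro card_sparse_tables_le) auto
      also have "\<dots> \<le> (n * n * (n * n)) ^ t"
      proof (intro power_mono mult_left_mono)
        have "C * n + 1 \<le> (C + 1) * n" using n by simp
        \<comment> \<open>For \<open>n \<ge> C + 1\<close> the possible values number at most n^2,
          so each nonzero entry has at most n^4 descriptions.\<close>
        also have "\<dots> \<le> n * n" using elim(3) by (intro mult_right_mono) auto
        finally show "C * n + 1 \<le> n * n" .
      qed auto
      finally have "real (card Sp) \<le> real ((n * n * (n * n)) ^ t)" by (simp only: of_nat_le_iff)
      also have "\<dots> = (real n powr 4) ^ t" using n by (simp add: powr_numeral power4_eq_xxxx mult.assoc)
      also have "\<dots> = (real n powr 4) powr real t" using n by (intro powr_realpow[symmetric]) simp
      also have "\<dots> = real n powr (4 * real t)" by (rule powr_powr)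
      also have "\<dots> \<le> real n powr (4 * real n powr (15/8))"
        using n by (intro powr_mono) (auto simp: t_def)
      also have "\<dots> = exp (4 * ln (real n) * real n powr (15/8))"
        using n by (simp add: powr_def mult_ac)
      also have "\<dots> = exp (4 * ln (real n) * real n powr (15/8) - ln 2 * ((real n - 1) / 2)\<^sup>2) * exp (ln 2 * ((real n - 1) / 2)\<^sup>2)"
        by (simp flip: exp_add)
      also have "\<dots> \<le> exp (- sqrt (real n) / 8) * real (card T)"
      proof (intro mult_mono asymp2)
        have "n \<le> 2 * h + 1" unfolding h_def by linarith
        then have "real n \<le> real (2 * h + 1)" by (rule of_nat_mono)
        then have "(real n - 1) / 2 \<le> real h" by simp
        then have "((real n - 1) / 2)\<^sup>2 \<le> real h ^ 2" using n by (intro power_mono) auto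
        then have "exp (ln 2 * ((real n - 1) / 2)\<^sup>2) \<le> exp (ln 2 * real h ^ 2)" by simp
        also have "\<dots> = 2 powr (real (h * h))" by (simp add: powr_def power2_eq_square mult_ac)
        also have "\<dots> = real (2 ^ (h * h))" by (subst powr_realpow) auto
        also have "\<dots> \<le> real (card T)"
          unfolding T_def using assms by (intro of_nat_mono card_tables_ge) (auto simp: h_def)
        finally show "exp (ln 2 * ((real n - 1) / 2)\<^sup>2) \<le> real (card T)" .
      qed auto
      finally show ?thesis .
    qed
    ultimately show ?case by (simp add: T_def algebra_simps)
  qed
qed

lemma nonzeros_Diff:
  assumes "finite R"
  shows "nonzeros {..<n} x j \<le> nonzeros ({..<n} - R) x j + card R"
proof -
  have "nonzeros {..<n} x j \<le> card ({i \<in> {..<n} - R. x i j \<noteq> 0} \<union> R)"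
    unfolding nonzeros_def using assms by (intro card_mono) auto
  also have "\<dots> \<le> nonzeros ({..<n} - R) x j + card R"
    unfolding nonzeros_def by (rule card_Un_le)
  finally show ?thesis .
qed

text \<open>The denominator bounds from below the number of nonzero entries outside \<open>c\<close>
  rows in any column of a good table; the numerator is the allowed difference of two columns plus
  the \<open>+ 1\<close> asked for by the switching estimate.\<close>

definition ratio_error :: "nat \<Rightarrow> nat \<Rightarrow> real" where
  "ratio_error c n = (real n powr (3/4) + 1) / (real n powr (7/8) - real c - real n powr (3/4))"

text \<open>One column is rich, removing the rows \<open>R\<close> costs it at most
  \<open>card R\<close>, and closeness of the counts passes the lower bound on to every
  column.\<close>

lemma good_tables_ratio:
  assumes x: "x \<in> good_tables N n R" and R: "finite R"
    and pos: "real n powr (7/8) - real (card R) - real n powr (3/4) > 0"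
    and jb: "j < n" "b < n"
  shows "nonzeros ({..<n} - R) x j > 0 \<and>
    \<bar>real (nonzeros ({..<n} - R) x j) - real (nonzeros ({..<n} - R) x b)\<bar> + 1
      \<le> ratio_error (card R) n * real (nonzeros ({..<n} - R) x j)"
proof -
  let ?\<nu> = "\<lambda>j. real (nonzeros ({..<n} - R) x j)"
  obtain k where k: "k < n" "real n powr (7/8) \<le> real (nonzeros {..<n} x k)"
    using x by (auto simp: good_tables_def)
  have "real (nonzeros {..<n} x k) \<le> ?\<nu> k + real (card R)"
    using nonzeros_Diff[OF R, of n x k] by (simp flip: of_nat_add)
  moreover have close: "\<bar>?\<nu> j - ?\<nu> l\<bar> < real n powr (3/4)" if "l < n" for l
    using x jb that by (auto simp: good_tables_def)
  ultimately have low: "real n powr (7/8) - real (card R) - real n powr (3/4) \<le> ?\<nu> j"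
    using k close[OF k(1)] by linarith
  then have "real n powr (3/4) + 1 \<le> ratio_error (card R) n * ?\<nu> j"
    using pos mult_left_mono[OF low, of "ratio_error (card R) n"] by (simp add: ratio_error_def)
  then show ?thesis using low pos close[OF jb(2)] by auto
qed

section \<open>Averages and the asymptotic switching relation\<close>

definition avg :: "nat \<Rightarrow> nat \<Rightarrow> ((nat \<Rightarrow> nat \<Rightarrow> nat) \<Rightarrow> real) \<Rightarrow> real" where
  "avg C n f = (\<Sum>x\<in>tables (C * n) n. f x) / real (card (tables (C * n) n))"

lemma card_tables_pos: "0 < real (card (tables N n))"
  using tables_nonempty by (simp add: card_gt_0_iff)

lemma avg_const [simp]: "avg C n (\<lambda>_. c) = c"
  using card_tables_pos[of "C * n" n] by (simp add: avg_def tables_nonempty)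

lemma card_mult_avg: "real (card (tables (C * n) n)) * avg C n f = (\<Sum>x\<in>tables (C * n) n. f x)"
  using card_tables_pos[of "C * n" n] by (simp add: avg_def tables_nonempty)

lemma avg_add: "avg C n (\<lambda>x. f x + g x) = avg C n f + avg C n g"
  by (simp add: avg_def sum.distrib add_divide_distrib)

lemma avg_cmult: "avg C n (\<lambda>x. c * f x) = c * avg C n f"
  by (simp add: avg_def sum_distrib_left[symmetric])

lemma avg_sum: "avg C n (\<lambda>x. \<Sum>i\<in>A. f i x) = (\<Sum>i\<in>A. avg C n (f i))"
  unfolding avg_def by (subst sum.swap) (simp add: sum_divide_distrib)

lemma avg_mono: "(\<And>x. x \<in> tables (C * n) n \<Longrightarrow> f x \<le> g x) \<Longrightarrow> avg C n f \<le> avg C n g"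
  unfolding avg_def by (intro divide_right_mono sum_mono) auto

lemma avg_nonneg: "(\<And>x. x \<in> tables (C * n) n \<Longrightarrow> 0 \<le> f x) \<Longrightarrow> 0 \<le> avg C n f"
  using avg_mono[of C n "\<lambda>_. 0" f] by simp

text \<open>The switching estimate is used with all rows outside \<open>R\<close> and all columns
  outside \<open>S\<close>, then divided by \<open>n\<close> times the number of tables. The omitted
  columns leave the terms with \<open>\<sigma>\<close> and \<open>card S\<close>. These, and the
  factor \<open>avg C n \<psi>\<close> of the error, stay explicit because the averages are not yet
  known to be bounded.\<close>

lemma switching_asymptotic:
  fixes \<phi> \<psi> :: "(nat \<Rightarrow> nat \<Rightarrow> nat) \<Rightarrow> real"
  assumes C: "C \<ge> 1" and fin: "finite R" "finite S" and ab: "a \<in> R" "b \<in> S"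
    and \<phi>_zero: "\<And>x. x a b = 0 \<Longrightarrow> \<phi> x = 0"
    and \<phi>_switch: "\<And>x i j. \<lbrakk>i \<notin> R; j \<notin> S\<rbrakk> \<Longrightarrow> \<phi> (switch a j i b x) = \<psi> x"
    and \<phi>_bounds: "\<And>N n x. x \<in> tables N n \<Longrightarrow> 0 \<le> \<phi> x \<and> \<phi> x \<le> real (N + 1) ^ d"
    and \<psi>_bounds: "\<And>N n x. x \<in> tables N n \<Longrightarrow> 0 \<le> \<psi> x \<and> \<psi> x \<le> real (N + 1) ^ d"
  defines "\<sigma> \<equiv> \<lambda>x :: nat \<Rightarrow> nat \<Rightarrow> nat. \<Sum>j\<in>S. real (x a j)"
  shows "\<exists>\<delta> e. \<delta> \<longlonglongrightarrow> 0 \<and> e \<longlonglongrightarrow> 0 \<and> (\<forall>\<^sub>F n in sequentially. 0 \<le> \<delta> n \<and>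
    \<bar>((1 + real C) * avg C n \<phi> - (card S * avg C n \<phi> + avg C n (\<lambda>x. \<phi> x * \<sigma> x)) / real n)
      - (real C * avg C n \<psi> - avg C n (\<lambda>x. \<psi> x * \<sigma> x) / real n)\<bar> \<le> \<delta> n * avg C n \<psi> + e n)"
proof -
  define \<delta> where "\<delta> = (\<lambda>n. ratio_error (card R) n * real C)"
  \<comment> \<open>The three factors come from the share of bad tables, from
    \<open>C * n + 1 \<le> (1 + C) * n\<close> in the bound for the test functions, and from the
    crude error term; after division by \<open>n\<close> the power \<open>Suc d\<close> of
    \<open>n\<close> remains.\<close>
  define K where "K = (4 * real C + 3) * (1 + real C) ^ d * (1 + 2 * real C)"
  define e where "e = (\<lambda>n. K * (real n ^ Suc d * exp (- sqrt (real n) / 8)))"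
  have "ratio_error (card R) \<longlonglongrightarrow> 0"
    unfolding ratio_error_def by real_asymp
  then have \<delta>_lim: "\<delta> \<longlonglongrightarrow> 0"
    unfolding \<delta>_def by (rule tendsto_mult_left_zero)
  have "(\<lambda>n. real n ^ Suc d * exp (- sqrt (real n) / 8)) \<longlonglongrightarrow> 0"
    by real_asymp
  then have e_lim: "e \<longlonglongrightarrow> 0"
    unfolding e_def by (rule tendsto_mult_right_zero)
  have "\<forall>\<^sub>F n in sequentially. 0 < real n powr (7/8) - real (card R) - real n powr (3/4)"
    by real_asymp
  moreover have "\<forall>\<^sub>F n in sequentially. R \<union> S \<subseteq> {..<n}"
  proof -
    have "\<forall>\<^sub>F n in sequentially. Suc (Max (R \<union> S)) \<le> n" by (rule eventually_ge_at_top)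
    then show ?thesis
    proof eventually_elim
      case (elim n)
      have "k \<le> Max (R \<union> S)" if "k \<in> R \<union> S" for k
        using that fin by (intro Max_ge) auto
      then show ?case using elim by fastforce
    qed
  qed
  ultimately have "\<forall>\<^sub>F n in sequentially. 0 \<le> \<delta> n \<and>
    \<bar>((1 + real C) * avg C n \<phi> - (card S * avg C n \<phi> + avg C n (\<lambda>x. \<phi> x * \<sigma> x)) / real n)
      - (real C * avg C n \<psi> - avg C n (\<lambda>x. \<psi> x * \<sigma> x) / real n)\<bar> \<le> \<delta> n * avg C n \<psi> + e n"
    using card_bad_tables_le[OF C, of R]
  proof eventually_elim
    case (elim n)
    let ?T = "tables (C * n) n" and ?J = "{..<n} - S" and ?G = "good_tables (C * n) n R"
    let ?c = "real (card ?T)"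
    have RS: "R \<subseteq> {..<n}" "S \<subseteq> {..<n}" and abn: "a < n" "b < n"
      using elim(2) ab by auto
    have n: "real n \<ge> 1" using abn by simp
    have c: "?c > 0" by (rule card_tables_pos)
    have \<rho>: "ratio_error (card R) n \<ge> 0"
      unfolding ratio_error_def using elim(1) by (intro divide_nonneg_pos) auto
    have cardJ: "real (card ?J) = real n - real (card S)"
      using RS fin by (simp add: card_Diff_subset of_nat_diff card_mono[of "{..<n}" S, simplified])
    have Z: "(\<Sum>j\<in>?J. real (x a j)) = real C * real n - \<sigma> x" if "x \<in> ?T" for x
    proof -
      have "(\<Sum>j\<in>?J. real (x a j)) = (\<Sum>j<n. real (x a j)) - \<sigma> x"
        unfolding \<sigma>_def using RS by (intro sum_diff) auto
      also have "(\<Sum>j<n. real (x a j)) = real C * real n"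
        using tables_row_sum[OF that abn(1)] by (simp flip: of_nat_sum)
      finally show ?thesis .
    qed
    have Z1: "(\<Sum>j\<in>?J. real (x a j) + 1) = (1 + real C) * real n - real (card S) - \<sigma> x" if "x \<in> ?T" for x
      using Z[OF that] cardJ by (simp add: sum.distrib algebra_simps)
    have alg: "c * m * (k * p - (s * p + q) / m) = (k * m - s) * (c * p) - c * q"
      "c * m * (k * p - q / m) = k * m * (c * p) - c * q" if "m \<noteq> 0" for c m k p s q :: real
      using that by (simp_all add: field_simps)
    have n0: "real n \<noteq> 0" using n by simp
    let ?A = "(1 + real C) * avg C n \<phi> - (card S * avg C n \<phi> + avg C n (\<lambda>x. \<phi> x * \<sigma> x)) / real n"
    let ?B = "real C * avg C n \<psi> - avg C n (\<lambda>x. \<psi> x * \<sigma> x) / real n"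
    have A: "(\<Sum>x\<in>?T. \<phi> x * (\<Sum>j\<in>?J. real (x a j) + 1)) = ?c * real n * ?A"
    proof -
      have "(\<Sum>x\<in>?T. \<phi> x * (\<Sum>j\<in>?J. real (x a j) + 1))
          = (\<Sum>x\<in>?T. ((1 + real C) * real n - real (card S)) * \<phi> x - \<phi> x * \<sigma> x)"
      proof (intro sum.cong refl)
        fix x assume "x \<in> ?T"
        from Z1[OF this] show "\<phi> x * (\<Sum>j\<in>?J. real (x a j) + 1)
            = ((1 + real C) * real n - real (card S)) * \<phi> x - \<phi> x * \<sigma> x"
          by (simp only:) (simp add: algebra_simps)
      qed
      also have "\<dots> = ((1 + real C) * real n - real (card S)) * (\<Sum>x\<in>?T. \<phi> x) - (\<Sum>x\<in>?T. \<phi> x * \<sigma> x)"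
        by (simp add: sum_subtractf sum_distrib_left)
      finally show ?thesis unfolding alg(1)[OF n0] card_mult_avg .
    qed
    have B: "(\<Sum>x\<in>?T. \<psi> x * (\<Sum>j\<in>?J. real (x a j))) = ?c * real n * ?B"
    proof -
      have "(\<Sum>x\<in>?T. \<psi> x * (\<Sum>j\<in>?J. real (x a j))) = (\<Sum>x\<in>?T. real C * real n * \<psi> x - \<psi> x * \<sigma> x)"
      proof (intro sum.cong refl)
        fix x assume "x \<in> ?T"
        from Z[OF this] show "\<psi> x * (\<Sum>j\<in>?J. real (x a j)) = real C * real n * \<psi> x - \<psi> x * \<sigma> x"
          by (simp only:) (simp add: algebra_simps)
      qed
      also have "\<dots> = real C * real n * (\<Sum>x\<in>?T. \<psi> x) - (\<Sum>x\<in>?T. \<psi> x * \<sigma> x)"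
        by (simp add: sum_subtractf sum_distrib_left)
      finally show ?thesis unfolding alg(2)[OF n0] card_mult_avg .
    qed
    \<comment> \<open>Dropping the nonnegative \<open>\<sigma>\<close> term lets the error be stated
      through \<open>avg C n \<psi>\<close> alone.\<close>
    have B_le: "?B \<le> real C * avg C n \<psi>"
      using n \<psi>_bounds by (auto intro!: divide_nonneg_nonneg avg_nonneg mult_nonneg_nonneg sum_nonneg simp: \<sigma>_def)
    have "\<bar>?c * real n * ?A - ?c * real n * ?B\<bar> \<le> ratio_error (card R) n * (?c * real n * ?B)
        + real (card (?T - ?G)) * (real (C * n + 1) ^ d * (real n + real (C * n) + real (C * n) * real n))"
      unfolding A[symmetric] B[symmetric]
    proof (rule switching_estimate[OF abn, of "{..<n} - R"])
      show "nonzeros ({..<n} - R) x j > 0 \<and>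
         \<bar>real (nonzeros ({..<n} - R) x j) - real (nonzeros ({..<n} - R) x b)\<bar> + 1
           \<le> ratio_error (card R) n * real (nonzeros ({..<n} - R) x j)"
        if "x \<in> ?G" "j \<in> ?J" for x j
        using good_tables_ratio[OF that(1) fin(1) elim(1)] that(2) abn by auto
      show "0 \<le> \<phi> x \<and> \<phi> x \<le> real (C * n + 1) ^ d" if "x \<in> ?T" for x
        using \<phi>_bounds[OF that] .
      show "0 \<le> \<psi> x \<and> \<psi> x \<le> real (C * n + 1) ^ d" if "x \<in> ?T" for x
        using \<psi>_bounds[OF that] .
    qed (use ab \<phi>_zero \<phi>_switch \<rho> in \<open>auto simp: good_tables_def\<close>)
    also have "real (card (?T - ?G)) * (real (C * n + 1) ^ d * (real n + real (C * n) + real (C * n) * real n))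
       \<le> ((4 * real C + 3) * exp (- sqrt (real n) / 8) * ?c) *
          (((1 + real C) * real n) ^ d * ((1 + 2 * real C) * real n * real n))"
    proof (intro mult_mono elim(3) power_mono)
      show "real (C * n + 1) \<le> (1 + real C) * real n" using n by (simp add: algebra_simps)
      have "real n * 1 \<le> real n * real n" using n by (intro mult_left_mono) auto
      moreover from this have "real C * (real n * 1) \<le> real C * (real n * real n)" by (rule mult_left_mono) simp
      ultimately show "real n + real (C * n) + real (C * n) * real n \<le> (1 + 2 * real C) * real n * real n"
        by (simp add: algebra_simps)
    qed auto
    also have "\<dots> = ?c * real n * e n"
      by (simp add: e_def K_def power_mult_distrib mult_ac)
    finally have "?c * real n * \<bar>?A - ?B\<bar> \<le> ?c * real n * (ratio_error (card R) n * ?B + e n)"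
      using c n by (simp add: abs_mult distrib_left mult_ac flip: right_diff_distrib)
    then have "\<bar>?A - ?B\<bar> \<le> ratio_error (card R) n * ?B + e n"
      using c n by (subst (asm) mult_le_cancel_left_pos) auto
    also have "ratio_error (card R) n * ?B \<le> \<delta> n * avg C n \<psi>"
      using mult_left_mono[OF B_le \<rho>] by (simp add: \<delta>_def mult_ac)
    finally show ?case using \<rho> by (simp add: \<delta>_def)
  qed
  then show ?thesis using \<delta>_lim e_lim by blast
qed

section \<open>Eventual boundedness of moments\<close>

definition bdd_avg :: "nat \<Rightarrow> ((nat \<Rightarrow> nat \<Rightarrow> nat) \<Rightarrow> real) \<Rightarrow> bool" where
  "bdd_avg C f \<longleftrightarrow> (\<exists>B. \<forall>\<^sub>F n in sequentially. avg C n f \<le> B)"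

lemma bdd_avg_const: "bdd_avg C (\<lambda>_. c)"
  by (auto simp: bdd_avg_def)

lemma bdd_avg_mono:
  assumes "bdd_avg C g" "\<And>x. f x \<le> g x"
  shows "bdd_avg C f"
proof -
  obtain B where "\<forall>\<^sub>F n in sequentially. avg C n g \<le> B"
    using assms(1) by (auto simp: bdd_avg_def)
  then have "\<forall>\<^sub>F n in sequentially. avg C n f \<le> B"
    by eventually_elim (rule order_trans[OF avg_mono[OF assms(2)]])
  then show ?thesis by (auto simp: bdd_avg_def)
qed

lemma bdd_avg_add:
  assumes "bdd_avg C f" "bdd_avg C g"
  shows "bdd_avg C (\<lambda>x. f x + g x)"
proof -
  obtain A B where "\<forall>\<^sub>F n in sequentially. avg C n f \<le> A" "\<forall>\<^sub>F n in sequentially. avg C n g \<le> B"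
    using assms by (auto simp: bdd_avg_def)
  then have "\<forall>\<^sub>F n in sequentially. avg C n (\<lambda>x. f x + g x) \<le> A + B"
    unfolding avg_add by eventually_elim (rule add_mono)
  then show ?thesis by (auto simp: bdd_avg_def)
qed

lemma bdd_avg_cmult:
  assumes "bdd_avg C f" "0 \<le> c"
  shows "bdd_avg C (\<lambda>x. c * f x)"
proof -
  obtain A where "\<forall>\<^sub>F n in sequentially. avg C n f \<le> A"
    using assms by (auto simp: bdd_avg_def)
  then have "\<forall>\<^sub>F n in sequentially. avg C n (\<lambda>x. c * f x) \<le> c * A"
    unfolding avg_cmult by eventually_elim (intro mult_left_mono assms)
  then show ?thesis by (auto simp: bdd_avg_def)
qed

lemma bdd_avg_sum:
  assumes "\<And>i. i \<in> A \<Longrightarrow> bdd_avg C (f i)"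
  shows "bdd_avg C (\<lambda>x. \<Sum>i\<in>A. f i x)"
  using assms
  by (induction A rule: infinite_finite_induct) (auto intro: bdd_avg_const bdd_avg_add)

text \<open>The pointwise bound f g \<le> f^2 + g^2 replaces Cauchy-Schwarz.\<close>

lemma bdd_avg_mult:
  assumes "bdd_avg C (\<lambda>x. (f x)\<^sup>2)" "bdd_avg C (\<lambda>x. (g x)\<^sup>2)"
  shows "bdd_avg C (\<lambda>x. f x * g x)"
proof (rule bdd_avg_mono[OF bdd_avg_add[OF assms]])
  fix x
  show "f x * g x \<le> (f x)\<^sup>2 + (g x)\<^sup>2"
    using sum_squares_bound[of "f x" "g x"] zero_le_power2[of "f x"] zero_le_power2[of "g x"] by linarith
qed

lemma power_add_one_expand:
  fixes y :: real
  shows "(y + 1) ^ m = y ^ m + (\<Sum>l<m. real (m choose l) * y ^ l)"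
  using binomial_ring[of y 1 m] by (simp add: lessThan_Suc_atMost[symmetric])

text \<open>Strong induction on \<open>m\<close>: the shifted power is \<open>\<phi>\<close> plus
  lower powers, so the switching relation bounds the average of \<open>\<phi>\<close> by
  \<open>C\<close> times that of the lower powers, up to errors that can be absorbed.\<close>

lemma bdd_avg_power:
  assumes "C \<ge> 1"
  shows "bdd_avg C (\<lambda>x. real (x a b) ^ m)"
proof (induction m rule: less_induct)
  case (less m)
  show ?case
  proof (cases "m = 0")
    case True
    then show ?thesis by (simp add: bdd_avg_const)
  next
    case False
    define \<phi> \<psi> low :: "(nat \<Rightarrow> nat \<Rightarrow> nat) \<Rightarrow> real" where
      "\<phi> = (\<lambda>x. real (x a b) ^ m)" and "\<psi> = (\<lambda>x. (real (x a b) + 1) ^ m)" and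
      "low = (\<lambda>x. \<Sum>l<m. real (m choose l) * real (x a b) ^ l)"
    let ?\<sigma> = "\<lambda>x. \<Sum>j\<in>{b}. real (x a j)"
    have "bdd_avg C low"
      unfolding low_def by (intro bdd_avg_sum bdd_avg_cmult less) auto
    then obtain B where B: "\<forall>\<^sub>F n in sequentially. avg C n low \<le> B"
      by (auto simp: bdd_avg_def)
    have "\<exists>\<delta> e. \<delta> \<longlonglongrightarrow> 0 \<and> e \<longlonglongrightarrow> 0 \<and> (\<forall>\<^sub>F n in sequentially. 0 \<le> \<delta> n \<and>
      \<bar>((1 + real C) * avg C n \<phi> - (card {b} * avg C n \<phi> + avg C n (\<lambda>x. \<phi> x * ?\<sigma> x)) / real n)
        - (real C * avg C n \<psi> - avg C n (\<lambda>x. \<psi> x * ?\<sigma> x) / real n)\<bar> \<le> \<delta> n * avg C n \<psi> + e n)"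
    proof (rule switching_asymptotic[OF assms, of "{a}" _ _ b _ _ m])
      show "\<phi> x = 0" if "x a b = 0" for x using that False by (simp add: \<phi>_def)
      show "\<phi> (switch a j i b x) = \<psi> x" if "i \<notin> {a}" "j \<notin> {b}" for x i j
        using that by (auto simp: \<phi>_def \<psi>_def switch_def add.commute)
      show "0 \<le> \<phi> x \<and> \<phi> x \<le> real (N + 1) ^ m" if "x \<in> tables N n" for N n x
        using tables_le[OF that, of a b] by (auto simp: \<phi>_def intro!: power_mono)
      show "0 \<le> \<psi> x \<and> \<psi> x \<le> real (N + 1) ^ m" if "x \<in> tables N n" for N n x
        using tables_le[OF that, of a b] by (auto simp: \<psi>_def intro!: power_mono)
    qed auto
    then obtain \<delta> e where \<delta>: "\<delta> \<longlonglongrightarrow> 0" and e: "e \<longlonglongrightarrow> 0" and main: "\<forall>\<^sub>F n in sequentially. 0 \<le> \<delta> n \<and>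
      \<bar>((1 + real C) * avg C n \<phi> - (card {b} * avg C n \<phi> + avg C n (\<lambda>x. \<phi> x * ?\<sigma> x)) / real n)
        - (real C * avg C n \<psi> - avg C n (\<lambda>x. \<psi> x * ?\<sigma> x) / real n)\<bar> \<le> \<delta> n * avg C n \<psi> + e n"
      by blast
    \<comment> \<open>With \<open>\<delta> n < 1/8\<close> and \<open>n \<ge> 8\<close> the errors
      contain at most a quarter of the average of \<open>\<phi>\<close>, which moves to the other
      side.\<close>
    have "\<forall>\<^sub>F n in sequentially. \<delta> n < 1/8"
      by (rule order_tendstoD(2)[OF \<delta>]) simp
    moreover have "\<forall>\<^sub>F n in sequentially. e n < 1"
      by (rule order_tendstoD(2)[OF e]) simp
    moreover have "\<forall>\<^sub>F n in sequentially. n \<ge> (8 :: nat)"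
      by (rule eventually_ge_at_top)
    ultimately have "\<forall>\<^sub>F n in sequentially. avg C n \<phi> \<le> 2 * ((real C + 1) * B + 1)"
      using B main
    proof eventually_elim
      case (elim n)
      let ?p = "avg C n \<phi>" and ?q = "avg C n low"
      let ?A = "avg C n (\<lambda>x. \<phi> x * ?\<sigma> x)" and ?B = "avg C n (\<lambda>x. \<psi> x * ?\<sigma> x)"
      have p: "0 \<le> ?p" by (intro avg_nonneg) (simp add: \<phi>_def)
      have q: "0 \<le> ?q" by (intro avg_nonneg) (auto simp: low_def intro: sum_nonneg)
      have \<psi>: "avg C n \<psi> = ?p + ?q"
        unfolding avg_add[symmetric] by (simp add: \<psi>_def \<phi>_def low_def power_add_one_expand)
      \<comment> \<open>These averages involve the power \<open>m + 1\<close>, for which no bound is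
        known yet. As \<phi> is at most \<psi>, their difference has the favourable sign and can be
        discarded.\<close>
      have "?A \<le> ?B"
        by (intro avg_mono mult_right_mono sum_nonneg) (auto simp: \<psi>_def \<phi>_def intro!: power_mono)
      then have "?A / real n \<le> ?B / real n" by (simp add: divide_right_mono)
      moreover have "?p / real n \<le> ?p / 8" using p elim(3) by (intro divide_left_mono) auto
      moreover have "\<delta> n * (?p + ?q) \<le> 1/8 * (?p + ?q)"
        using p q elim(1) by (intro mult_right_mono) auto
      moreover have "(1 + real C) * ?p - (?p / real n + ?A / real n) - ((real C * ?p + real C * ?q) - ?B / real n)
          \<le> \<delta> n * (?p + ?q) + e n"
        using elim(5) unfolding \<psi> by (simp add: add_divide_distrib distrib_left abs_le_iff)
      moreover have "(1 + real C) * ?p = ?p + real C * ?p" by (simp add: distrib_right)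
      moreover have "real C * ?q \<le> real C * B" using elim(4) by (intro mult_left_mono) auto
      moreover have "(real C + 1) * B = real C * B + B" by (simp add: distrib_right)
      moreover have "0 \<le> real C * ?q" using q by simp
      ultimately show ?case using p q elim(2,4) by argo
    qed
    then show ?thesis unfolding bdd_avg_def \<phi>_def by blast
  qed
qed

section \<open>Limits of mixed moments\<close>

definition monomial :: "nat \<Rightarrow> (nat \<Rightarrow> nat) \<Rightarrow> (nat \<Rightarrow> nat) \<Rightarrow> (nat \<Rightarrow> nat) \<Rightarrow> (nat \<Rightarrow> nat \<Rightarrow> nat) \<Rightarrow> real" where
  "monomial L i j \<alpha> x = (\<Prod>k<L. real (x (i k) (j k)) ^ \<alpha> k)"

lemma monomial_nonneg: "0 \<le> monomial L i j \<alpha> x"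
  unfolding monomial_def by (intro prod_nonneg) auto

lemma monomial_square: "(monomial L i j \<alpha> x)\<^sup>2 = monomial L i j (\<lambda>k. \<alpha> k * 2) x"
  unfolding monomial_def by (simp add: prod_power_distrib power_mult)

text \<open>Each factor is split off through its square, which doubles the remaining exponents;
  hence the induction is over all exponents at once.\<close>

lemma bdd_avg_monomial:
  assumes "C \<ge> 1"
  shows "bdd_avg C (monomial L i j \<alpha>)"
proof (induction L arbitrary: \<alpha>)
  case 0
  then show ?case by (simp add: monomial_def bdd_avg_const)
next
  case (Suc L)
  have "monomial (Suc L) i j \<alpha> = (\<lambda>x. monomial L i j \<alpha> x * real (x (i L) (j L)) ^ \<alpha> L)"
    by (simp add: monomial_def fun_eq_iff)
  moreover have "bdd_avg C (\<lambda>x. monomial L i j \<alpha> x * real (x (i L) (j L)) ^ \<alpha> L)"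
    using bdd_avg_power[OF assms, of "i L" "j L" "\<alpha> L * 2"]
    by (intro bdd_avg_mult) (simp_all only: monomial_square Suc power_mult)
  ultimately show ?case by simp
qed

lemma bdd_avg_monomial_mult:
  assumes "C \<ge> 1"
  shows "bdd_avg C (\<lambda>x. monomial L i j \<alpha> x * real (x a b))"
  using bdd_avg_power[OF assms, of a b 2]
  by (intro bdd_avg_mult) (simp_all only: monomial_square bdd_avg_monomial[OF assms])

lemma monomial_fun_upd:
  assumes "k < L"
  shows "monomial L i j (\<alpha>(k := l)) x
    = real (x (i k) (j k)) ^ l * (\<Prod>k'\<in>{..<L} - {k}. real (x (i k') (j k')) ^ \<alpha> k')"
  using assms unfolding monomial_def by (subst prod.remove[of _ k]) auto

text \<open>Induction on the total degree. Switching at one cell with positive exponent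
  \<open>m\<close> expresses the average, up to o(1), through averages with that exponent lowered;
  the limits then satisfy the recursion assumed for \<open>\<mu>\<close>.\<close>

lemma avg_monomial_tendsto:
  fixes \<mu> :: "nat \<Rightarrow> real"
  assumes C: "C \<ge> 1" and inj: "inj_on (\<lambda>k. (i k, j k)) {..<L}"
    and \<mu>0: "\<mu> 0 = 1"
    and \<mu>_rec: "\<And>m. m \<ge> 1 \<Longrightarrow> \<mu> m = real C * (\<Sum>l<m. real (m choose l) * \<mu> l)"
  shows "(\<lambda>n. avg C n (monomial L i j \<alpha>)) \<longlonglongrightarrow> (\<Prod>k<L. \<mu> (\<alpha> k))"
proof (induction "\<Sum>k<L. \<alpha> k" arbitrary: \<alpha> rule: less_induct)
  case less
  show ?case
  proof (cases "\<forall>k<L. \<alpha> k = 0")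
    case True
    then have "monomial L i j \<alpha> = (\<lambda>_. 1)" by (simp add: monomial_def fun_eq_iff)
    then show ?thesis using True \<mu>0 by simp
  next
    case False
    then obtain k where k: "k < L" "\<alpha> k \<ge> 1" by (auto simp: Suc_le_eq)
    define a b m where "a = i k" and "b = j k" and "m = \<alpha> k"
    have m1: "m \<ge> 1" using k by (simp add: m_def)
    \<comment> \<open>The switched row and column are taken outside all rows and columns of the
      monomial, so only the cell \<open>(a, b)\<close> among its cells is altered.\<close>
    define R S where "R = i ` {..<L}" and "S = j ` {..<L}"
    define rest where "rest = (\<lambda>x :: nat \<Rightarrow> nat \<Rightarrow> nat. \<Prod>k'\<in>{..<L} - {k}. real (x (i k') (j k')) ^ \<alpha> k')"
    define M where "M = (\<lambda>l. monomial L i j (\<alpha>(k := l)))"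
    have M: "M l x = real (x a b) ^ l * rest x" for l x
      unfolding M_def rest_def a_def b_def by (rule monomial_fun_upd[OF k(1)])
    have M_nonneg: "0 \<le> M l x" for l x unfolding M_def by (rule monomial_nonneg)
    have M\<alpha>: "M m = monomial L i j \<alpha>" by (simp add: M_def m_def)
    define \<psi> where "\<psi> = (\<lambda>x :: nat \<Rightarrow> nat \<Rightarrow> nat. (real (x a b) + 1) ^ m * rest x)"
    have \<psi>: "\<psi> x = M m x + (\<Sum>l<m. real (m choose l) * M l x)" for x
      unfolding \<psi>_def power_add_one_expand M by (simp add: algebra_simps sum_distrib_left)
    let ?\<sigma> = "\<lambda>x. \<Sum>j\<in>S. real (x a j)"
    have \<sigma>_nonneg: "0 \<le> ?\<sigma> x" for x by (intro sum_nonneg) auto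
    have rest_bounds: "0 \<le> rest x \<and> rest x \<le> real (N + 1) ^ (\<Sum>k'\<in>{..<L} - {k}. \<alpha> k')" if "x \<in> tables N n" for N n x
    proof
      show "0 \<le> rest x" unfolding rest_def by (intro prod_nonneg) auto
      have "rest x \<le> (\<Prod>k'\<in>{..<L} - {k}. real (N + 1) ^ \<alpha> k')"
        unfolding rest_def
      proof (intro prod_mono conjI power_mono)
        show "real (x (i k') (j k')) \<le> real (N + 1)" for k'
          using tables_le[OF that, of "i k'" "j k'"] by simp
      qed auto
      then show "rest x \<le> real (N + 1) ^ (\<Sum>k'\<in>{..<L} - {k}. \<alpha> k')"
        by (simp add: power_sum)
    qed
    have sum_\<alpha>: "(\<Sum>k<L. \<alpha> k) = m + (\<Sum>k'\<in>{..<L} - {k}. \<alpha> k')"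
      unfolding m_def using k(1) by (intro sum.remove) auto
    have "\<exists>\<delta> e. \<delta> \<longlonglongrightarrow> 0 \<and> e \<longlonglongrightarrow> 0 \<and> (\<forall>\<^sub>F n in sequentially. 0 \<le> \<delta> n \<and>
      \<bar>((1 + real C) * avg C n (M m) - (card S * avg C n (M m) + avg C n (\<lambda>x. M m x * ?\<sigma> x)) / real n)
        - (real C * avg C n \<psi> - avg C n (\<lambda>x. \<psi> x * ?\<sigma> x) / real n)\<bar> \<le> \<delta> n * avg C n \<psi> + e n)"
    proof (rule switching_asymptotic[OF C, of R _ _ b _ _ "\<Sum>k<L. \<alpha> k"])
      show "finite R" "finite S" "a \<in> R" "b \<in> S" using k by (auto simp: R_def S_def a_def b_def)
      show "M m x = 0" if "x a b = 0" for x
        using that k by (simp add: M m_def)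
      show "M m (switch a j' i' b x) = \<psi> x" if "i' \<notin> R" "j' \<notin> S" for x i' j'
      proof -
        have "rest (switch a j' i' b x) = rest x"
          unfolding rest_def
        proof (intro prod.cong refl)
          fix k' assume k': "k' \<in> {..<L} - {k}"
          \<comment> \<open>Distinctness of the cells is used here: a repeated cell would make
            \<open>rest\<close> change too.\<close>
          then have "(i k', j k') \<noteq> (a, b)"
            using inj k(1) unfolding a_def b_def inj_on_def by blast
          moreover have "i k' \<noteq> i'" "j k' \<noteq> j'" using k' that by (auto simp: R_def S_def)
          ultimately show "real (switch a j' i' b x (i k') (j k')) ^ \<alpha> k' = real (x (i k') (j k')) ^ \<alpha> k'"
            by (auto simp: switch_def)
        qed
        moreover have "a \<noteq> i'" "b \<noteq> j'" using that k by (auto simp: R_def S_def a_def b_def)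
        then have "real (switch a j' i' b x a b) = real (x a b) + 1"
          by (simp add: switch_def)
        ultimately show ?thesis unfolding M \<psi>_def by simp
      qed
      show "0 \<le> M m x \<and> M m x \<le> real (N + 1) ^ (\<Sum>k<L. \<alpha> k)" if "x \<in> tables N n" for N n x
        unfolding M sum_\<alpha> power_add using rest_bounds[OF that] tables_le[OF that, of a b]
        by (intro conjI mult_nonneg_nonneg mult_mono power_mono) auto
      show "0 \<le> \<psi> x \<and> \<psi> x \<le> real (N + 1) ^ (\<Sum>k<L. \<alpha> k)" if "x \<in> tables N n" for N n x
        unfolding \<psi>_def sum_\<alpha> power_add using rest_bounds[OF that] tables_le[OF that, of a b]
        by (intro conjI mult_nonneg_nonneg mult_mono power_mono) auto
    qed
    then obtain \<delta> e where \<delta>: "\<delta> \<longlonglongrightarrow> 0" and e: "e \<longlonglongrightarrow> 0" and main: "\<forall>\<^sub>F n in sequentially. 0 \<le> \<delta> n \<and>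
      \<bar>((1 + real C) * avg C n (M m) - (card S * avg C n (M m) + avg C n (\<lambda>x. M m x * ?\<sigma> x)) / real n)
        - (real C * avg C n \<psi> - avg C n (\<lambda>x. \<psi> x * ?\<sigma> x) / real n)\<bar> \<le> \<delta> n * avg C n \<psi> + e n"
      by blast

    have bdd_M: "bdd_avg C (M l)" for l
      unfolding M_def by (rule bdd_avg_monomial[OF C])
    have bdd_M\<sigma>: "bdd_avg C (\<lambda>x. M l x * ?\<sigma> x)" for l
      unfolding M_def sum_distrib_left by (intro bdd_avg_sum bdd_avg_monomial_mult[OF C])
    have \<psi>_fun: "\<psi> = (\<lambda>x. M m x + (\<Sum>l<m. real (m choose l) * M l x))" using \<psi> by blast
    have bdd_\<psi>: "bdd_avg C \<psi>"
      unfolding \<psi>_fun by (intro bdd_avg_add bdd_avg_sum bdd_avg_cmult bdd_M) auto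
    have "(\<lambda>x. \<psi> x * ?\<sigma> x) = (\<lambda>x. M m x * ?\<sigma> x + (\<Sum>l<m. real (m choose l) * (M l x * ?\<sigma> x)))"
      by (simp add: \<psi>_fun distrib_right sum_distrib_right[of _ _ "?\<sigma> _"] mult.assoc)
    then have bdd_\<psi>\<sigma>: "bdd_avg C (\<lambda>x. \<psi> x * ?\<sigma> x)"
      by (simp only:) (intro bdd_avg_add bdd_avg_sum bdd_avg_cmult bdd_M\<sigma>, auto)
    obtain B1 where B1: "\<forall>\<^sub>F n in sequentially. avg C n \<psi> \<le> B1"
      using bdd_\<psi> by (auto simp: bdd_avg_def)
    \<comment> \<open>All averages divided by \<open>n\<close> in the switching relation are
      bounded, so their contribution is O(1/n).\<close>
    have "bdd_avg C (\<lambda>x. card S * M m x + M m x * ?\<sigma> x + \<psi> x * ?\<sigma> x)"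
      by (intro bdd_avg_add bdd_avg_cmult bdd_M bdd_M\<sigma> bdd_\<psi>\<sigma>) auto
    then obtain B2 where B2: "\<forall>\<^sub>F n in sequentially. card S * avg C n (M m) + avg C n (\<lambda>x. M m x * ?\<sigma> x)
        + avg C n (\<lambda>x. \<psi> x * ?\<sigma> x) \<le> B2"
      unfolding bdd_avg_def avg_add avg_cmult by blast
    define D where "D = (\<lambda>n. (1 + real C) * avg C n (M m) - real C * avg C n \<psi>)"
    have "\<forall>\<^sub>F n in sequentially. norm (D n) \<le> \<delta> n * B1 + e n + B2 / real n"
      using main B1 B2
    proof eventually_elim
      case (elim n)
      let ?U = "card S * avg C n (M m) + avg C n (\<lambda>x. M m x * ?\<sigma> x)"
      let ?V = "avg C n (\<lambda>x. \<psi> x * ?\<sigma> x)"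
      have \<psi>_nonneg: "0 \<le> \<psi> x" for x
        unfolding \<psi> by (intro add_nonneg_nonneg sum_nonneg mult_nonneg_nonneg M_nonneg) auto
      have "0 \<le> ?U / real n"
        by (intro divide_nonneg_nonneg add_nonneg_nonneg mult_nonneg_nonneg avg_nonneg M_nonneg \<sigma>_nonneg) auto
      moreover have "0 \<le> ?V / real n"
        by (intro divide_nonneg_nonneg mult_nonneg_nonneg avg_nonneg \<psi>_nonneg \<sigma>_nonneg) auto
      moreover have "?U / real n + ?V / real n \<le> B2 / real n"
        using elim(3) by (simp add: add_divide_distrib[symmetric] divide_right_mono)
      moreover have "\<delta> n * avg C n \<psi> \<le> \<delta> n * B1" using elim by (intro mult_left_mono) auto
      ultimately show ?case using elim(1) unfolding D_def real_norm_def by argo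
    qed
    moreover have "(\<lambda>n. \<delta> n * B1 + e n + B2 / real n) \<longlonglongrightarrow> 0 * B1 + 0 + 0"
      by (intro tendsto_intros \<delta> e lim_const_over_n)
    then have "(\<lambda>n. \<delta> n * B1 + e n + B2 / real n) \<longlonglongrightarrow> 0" by simp
    ultimately have D: "D \<longlonglongrightarrow> 0" by (rule Lim_null_comparison)

    have M_lim: "(\<lambda>n. avg C n (M l)) \<longlonglongrightarrow> \<mu> l * (\<Prod>k'\<in>{..<L} - {k}. \<mu> (\<alpha> k'))" if "l < m" for l
    proof -
      have prod: "(\<Prod>k'<L. \<mu> ((\<alpha>(k := l)) k')) = \<mu> l * (\<Prod>k'\<in>{..<L} - {k}. \<mu> (\<alpha> k'))"
        using k(1) by (subst prod.remove[of _ k]) auto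
      have "(\<Sum>k'<L. (\<alpha>(k := l)) k') = l + (\<Sum>k'\<in>{..<L} - {k}. \<alpha> k')"
        using k(1) by (subst sum.remove[of _ k]) auto
      then have "(\<Sum>k'<L. (\<alpha>(k := l)) k') < (\<Sum>k<L. \<alpha> k)"
        using that sum_\<alpha> by simp
      from less[OF this] show ?thesis unfolding M_def prod .
    qed
    \<comment> \<open>The top monomial occurs in \<open>\<psi>\<close> with coefficient 1, so
      \<open>(1 + C) - C = 1\<close> copy of it is left.\<close>
    have avg_eq: "avg C n (M m) = D n + real C * (\<Sum>l<m. real (m choose l) * avg C n (M l))" for n
      unfolding D_def \<psi>_fun avg_add avg_sum avg_cmult by (simp add: algebra_simps)
    have "(\<lambda>n. avg C n (M m)) \<longlonglongrightarrow>
        0 + real C * (\<Sum>l<m. real (m choose l) * (\<mu> l * (\<Prod>k'\<in>{..<L} - {k}. \<mu> (\<alpha> k'))))"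
      unfolding avg_eq by (intro tendsto_intros D M_lim) auto
    also have "0 + real C * (\<Sum>l<m. real (m choose l) * (\<mu> l * (\<Prod>k'\<in>{..<L} - {k}. \<mu> (\<alpha> k'))))
        = \<mu> m * (\<Prod>k'\<in>{..<L} - {k}. \<mu> (\<alpha> k'))"
      unfolding \<mu>_rec[OF m1] by (simp add: sum_distrib_right sum_distrib_left mult_ac)
    also have "\<dots> = (\<Prod>k<L. \<mu> (\<alpha> k))"
      unfolding m_def using k(1) by (intro prod.remove[symmetric]) auto
    finally show ?thesis unfolding M\<alpha> .
  qed
qed

section \<open>Geometric moments\<close>

lemma summable_power_mult_geometric:
  fixes p :: real
  assumes "0 < p" "p < 1"
  shows "summable (\<lambda>x. real x ^ m * p ^ x)"
proof (rule summable_comparison_test_bigo)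
  show "summable (\<lambda>x. norm (real x powr - 2))"
    by (simp add: summable_real_powr_iff)
  show "(\<lambda>x. real x ^ m * p ^ x) \<in> O(\<lambda>x. real x powr - 2)"
    using assms by real_asymp
qed

text \<open>The division by \<open>1 + real C\<close> is multiplication by the probability of the
  value 0.\<close>

definition geometric_moment :: "nat \<Rightarrow> nat \<Rightarrow> real" where
  "geometric_moment C m = (\<Sum>x. real x ^ m * (real C / (1 + real C)) ^ x) / (1 + real C)"

text \<open>Shifting the summation index and expanding \<open>(x + 1) ^ m\<close> gives an equation
  containing the top moment on both sides; solving for it produces p / (1 - p) = C.\<close>

lemma geometric_moment_rec:
  assumes "C \<ge> 1"
  shows "geometric_moment C 0 = 1"
    and "m \<ge> 1 \<Longrightarrow> geometric_moment C m = real C * (\<Sum>l<m. real (m choose l) * geometric_moment C l)"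
proof -
  define p where "p = real C / (1 + real C)"
  have p: "0 < p" "p < 1" using assms by (auto simp: p_def field_simps)
  define S where "S = (\<lambda>m. \<Sum>x. real x ^ m * p ^ x)"
  have moment: "geometric_moment C m = S m / (1 + real C)" for m
    by (simp add: geometric_moment_def S_def p_def)
  have sums: "(\<lambda>x. real x ^ m * p ^ x) sums S m" for m
    unfolding S_def by (intro summable_sums summable_power_mult_geometric p)
  have "(\<lambda>x. p ^ x) sums (1 / (1 - p))" using p by (intro geometric_sums) auto
  then have "S 0 = 1 / (1 - p)" using sums_unique2[OF sums[of 0]] by simp
  also have "1 / (1 - p) = 1 + real C" using assms by (simp add: p_def field_simps)
  finally show "geometric_moment C 0 = 1" by (simp add: moment)
  show "geometric_moment C m = real C * (\<Sum>l<m. real (m choose l) * geometric_moment C l)" if m: "m \<ge> 1"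
  proof -
    have "(\<lambda>x. p * (real x ^ m * p ^ x + (\<Sum>l<m. real (m choose l) * (real x ^ l * p ^ x))))
        sums (p * (S m + (\<Sum>l<m. real (m choose l) * S l)))"
      by (intro sums_mult sums_add sums_sum sums)
    moreover have "p * (real x ^ m * p ^ x + (\<Sum>l<m. real (m choose l) * (real x ^ l * p ^ x)))
        = real (Suc x) ^ m * p ^ Suc x" for x
    proof -
      have "real (Suc x) ^ m = real x ^ m + (\<Sum>l<m. real (m choose l) * real x ^ l)"
        using power_add_one_expand[of "real x" m] by (simp add: add.commute)
      then show ?thesis by (simp add: algebra_simps sum_distrib_left)
    qed
    ultimately have "(\<lambda>x. real (Suc x) ^ m * p ^ Suc x) sums (p * (S m + (\<Sum>l<m. real (m choose l) * S l)))"
      by simp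
    \<comment> \<open>The term at index 0 missing from the shifted series vanishes, since
      \<open>m \<ge> 1\<close>.\<close>
    then have "(\<lambda>x. real x ^ m * p ^ x) sums (p * (S m + (\<Sum>l<m. real (m choose l) * S l)))"
      using m by (subst (asm) sums_Suc_iff) (simp add: power_0_left)
    then have "S m = p * (S m + (\<Sum>l<m. real (m choose l) * S l))"
      using sums sums_unique2 by blast
    then have "S m = real C * (\<Sum>l<m. real (m choose l) * S l)"
      by (simp add: p_def field_simps)
    then show ?thesis by (simp add: moment sum_divide_distrib[symmetric])
  qed
qed

text \<open>Point probabilities determine the law of \<open>Y\<close> on a countable space, so the
  expectation becomes an integral against counting measure, that is, the series of
  \<open>geometric_moment\<close>.\<close>

lemma (in prob_space) expectation_power_geometric:
  fixes Y :: "'a \<Rightarrow> nat"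
  assumes C: "C \<ge> 1" and Y[measurable]: "Y \<in> measurable M (count_space UNIV)"
    and law: "\<And>x. prob {\<omega> \<in> space M. Y \<omega> = x} = 1 / (1 + real C) * (real C / (1 + real C)) ^ x"
  shows "integrable M (\<lambda>\<omega>. real (Y \<omega>) ^ m)"
    and "expectation (\<lambda>\<omega>. real (Y \<omega>) ^ m) = geometric_moment C m"
proof -
  define p where "p = real C / (1 + real C)"
  have p: "0 < p" "p < 1" using C by (auto simp: p_def field_simps)
  have eq: "distr M (count_space UNIV) Y = density (count_space UNIV) (\<lambda>x. ennreal (p ^ x / (1 + real C)))"
  proof (rule measure_eqI_countable[of _ UNIV])
    fix x :: nat
    have "Y -` {x} \<inter> space M = {\<omega> \<in> space M. Y \<omega> = x}" by auto
    then show "emeasure (distr M (count_space UNIV) Y) {x}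
        = emeasure (density (count_space UNIV) (\<lambda>x. ennreal (p ^ x / (1 + real C)))) {x}"
      using law[of x] by (simp add: emeasure_distr emeasure_density emeasure_eq_measure p_def
          nn_integral_count_space_indicator[symmetric] nn_integral_indicator_singleton)
  qed auto
  have summ: "summable (\<lambda>x. real x ^ m * p ^ x)"
    by (rule summable_power_mult_geometric[OF p])
  have eq': "(\<lambda>x. (p ^ x / (1 + real C)) *\<^sub>R real x ^ m) = (\<lambda>x. real x ^ m * p ^ x / (1 + real C))"
    by (auto simp: fun_eq_iff)
  have int': "integrable (count_space UNIV) (\<lambda>x. (p ^ x / (1 + real C)) *\<^sub>R real x ^ m)"
    unfolding eq' integrable_count_space_nat_iff using summ p by (simp add: summable_divide)
  have int: "integrable (distr M (count_space UNIV) Y) (\<lambda>x. real x ^ m)"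
    unfolding eq using int' p by (subst integrable_density) auto
  then show "integrable M (\<lambda>\<omega>. real (Y \<omega>) ^ m)"
    by (subst (asm) integrable_distr_eq) auto
  have "expectation (\<lambda>\<omega>. real (Y \<omega>) ^ m) = integral\<^sup>L (distr M (count_space UNIV) Y) (\<lambda>x. real x ^ m)"
    by (subst integral_distr) auto
  also have "\<dots> = integral\<^sup>L (count_space UNIV) (\<lambda>x. (p ^ x / (1 + real C)) *\<^sub>R real x ^ m)"
    unfolding eq using p by (subst integral_density) auto
  also have "\<dots> = (\<Sum>x. (p ^ x / (1 + real C)) *\<^sub>R real x ^ m)"
    by (rule integral_count_space_nat[OF int'])
  also have "\<dots> = geometric_moment C m"
    unfolding eq' geometric_moment_def p_def[symmetric] by (rule suminf_divide[OF summ])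
  finally show "expectation (\<lambda>\<omega>. real (Y \<omega>) ^ m) = geometric_moment C m" .
qed

section \<open>Return to matrices and conclusion\<close>

lemma expectation_margin_mats_eq_avg:
  assumes "\<And>k. k < L \<Longrightarrow> i k < n \<and> j k < n"
  shows "measure_pmf.expectation (pmf_of_set (margin_mats (C * n) n))
      (\<lambda>X. \<Prod>k<L. real (X $$ (i k, j k)) ^ \<alpha> k) = avg C n (monomial L i j \<alpha>)"
proof -
  let ?F = "\<lambda>X i j. if i < n \<and> j < n then X $$ (i, j) else 0 :: nat"
  have bij: "bij_betw ?F (margin_mats (C * n) n) (tables (C * n) n)"
    by (rule bij_betw_margin_mats_tables)
  have "(\<Sum>x\<in>tables (C * n) n. monomial L i j \<alpha> x) = (\<Sum>X\<in>margin_mats (C * n) n. monomial L i j \<alpha> (?F X))"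
    by (rule sum.reindex_bij_betw[OF bij, symmetric])
  also have "\<dots> = (\<Sum>X\<in>margin_mats (C * n) n. \<Prod>k<L. real (X $$ (i k, j k)) ^ \<alpha> k)"
    using assms by (simp add: monomial_def)
  finally show ?thesis
    using bij_betw_same_card[OF bij]
    by (simp add: integral_pmf_of_set margin_mats_nonempty finite_margin_mats avg_def)
qed

theorem theorem1p4:
  fixes C L :: nat
    and i j \<alpha> :: "nat \<Rightarrow> nat"
    and M :: "'a measure"
    and Y :: "nat \<Rightarrow> 'a \<Rightarrow> nat"
  assumes "C \<ge> 2"
    and "inj_on (\<lambda>k. (i k, j k)) {..<L}"
    and "\<And>k. k < L \<Longrightarrow> \<alpha> k \<ge> 1"
    and "prob_space M"
    and "prob_space.indep_vars M (\<lambda>_. count_space UNIV) Y {..<L}"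
    and "\<And>k x. k < L \<Longrightarrow> measure M {\<omega> \<in> space M. Y k \<omega> = x} =
           1 / (1 + real C) * (real C / (1 + real C)) ^ x"
  shows "(\<lambda>n. measure_pmf.expectation (pmf_of_set (margin_mats (C * n) n))
             (\<lambda>X. \<Prod>k<L. real (X $$ (i k, j k)) ^ \<alpha> k))
         \<longlonglongrightarrow> prob_space.expectation M (\<lambda>\<omega>. \<Prod>k<L. real (Y k \<omega>) ^ \<alpha> k)"
proof -
  interpret prob_space M by fact
  have C: "C \<ge> 1" using assms(1) by simp
  have Y: "Y k \<in> measurable M (count_space UNIV)" if "k < L" for k
    using assms(5) that by (auto simp: indep_vars_def)
  have "indep_vars (\<lambda>_. borel) (\<lambda>k \<omega>. real (Y k \<omega>) ^ \<alpha> k) {..<L}"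
    by (rule indep_vars_compose2[OF assms(5)]) auto
  then have "expectation (\<lambda>\<omega>. \<Prod>k<L. real (Y k \<omega>) ^ \<alpha> k) = (\<Prod>k<L. expectation (\<lambda>\<omega>. real (Y k \<omega>) ^ \<alpha> k))"
    using expectation_power_geometric(1)[OF C Y assms(6)]
    by (intro indep_vars_lebesgue_integral) auto
  also have "\<dots> = (\<Prod>k<L. geometric_moment C (\<alpha> k))"
    using expectation_power_geometric(2)[OF C Y assms(6)] by (intro prod.cong) auto
  finally have limit: "expectation (\<lambda>\<omega>. \<Prod>k<L. real (Y k \<omega>) ^ \<alpha> k) = (\<Prod>k<L. geometric_moment C (\<alpha> k))" .
  \<comment> \<open>For small \<open>n\<close> some cells lie outside the matrix, where
    \<open>$$\<close> carries no information; the two averages are therefore identified only for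
    large \<open>n\<close>.\<close>
  have "\<forall>\<^sub>F n in sequentially. \<forall>k\<in>{..<L}. i k < n \<and> j k < n"
    by (intro eventually_ball_finite ballI eventually_conj eventually_gt_at_top) auto
  then have "\<forall>\<^sub>F n in sequentially. avg C n (monomial L i j \<alpha>)
      = measure_pmf.expectation (pmf_of_set (margin_mats (C * n) n))
          (\<lambda>X. \<Prod>k<L. real (X $$ (i k, j k)) ^ \<alpha> k)"
    by eventually_elim (rule expectation_margin_mats_eq_avg[symmetric], auto)
  moreover have "(\<lambda>n. avg C n (monomial L i j \<alpha>)) \<longlonglongrightarrow> (\<Prod>k<L. geometric_moment C (\<alpha> k))"
    by (intro avg_monomial_tendsto C assms(2) geometric_moment_rec)
  ultimately show ?thesis unfolding limit by (rule Lim_transform_eventually[rotated])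
qed

end
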